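(* Let $l \in \mathbb{Z}_{\ge 0}$, and let $\mathcal{D}$, $\mathcal{B}_{Y|X}$, $\delta(z_2,z_4)$, $\mathcal{I}_{1l}$, $\mathcal{I}_3$, $\mathcal{M}_{1l}=\mathcal{D}/\mathcal{I}_{1l}$ and $\mathcal{M}_3=\mathcal{D}/\mathcal{I}_3$ be as defined in the context. (i) The map $\mathcal{M}_{1l} \to \mathcal{B}_{Y|X}$ sending the class of $P \in \mathcal{D}$ to $P\,\bigl(z_1 \tfrac{\partial}{\partial z_2}\bigr)^l \delta(z_2,z_4)$ is a well-defined isomorphism of left $\mathcal{D}$-modules. In particular, $\mathcal{M}_{1l}$ is a simple holonomic system. (ii) The natural $\mathcal{D}$-module homomorphism $\mathcal{M}_3 \to \mathcal{M}_{1l}$ (sending the class of $P$ to the class of $P$) is surjective. (iii) For any positive integer $L$, the natural $\mathcal{D}$-module homomorphism $\mathcal{M}_3 \to \bigoplus_{l=0}^{L} \mathcal{M}_{1l}$ (sending the class of $P$ to the tuple of classes of $P$) is surjective.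
   Context: Let $X=\mathbb{C}^4$ with coordinates $(z_1,z_2,z_3,z_4)$, and let $\mathcal{D}=\mathbb{C}[z_1,z_2,z_3,z_4,\frac{\partial}{\partial z_1},\frac{\partial}{\partial z_2},\frac{\partial}{\partial z_3},\frac{\partial}{\partial z_4}]$ be the ring of differential operators with polynomial coefficients (the Weyl algebra). All modules are left $\mathcal{D}$-modules. Let $Y=\{z_2=z_4=0\}\subset X$ and define the left $\mathcal{D}$-module $$\mathcal{B}_{Y|X}=\mathcal{D}/\Bigl(\mathcal{D}\tfrac{\partial}{\partial z_1}+\mathcal{D}z_2+\mathcal{D}\tfrac{\partial}{\partial z_3}+\mathcal{D}z_4\Bigr)$$ (which equals the algebraic local cohomology module $\mathcal{H}^2_{[Y]}(\mathcal{O}_X)$). The class of $1\in\mathcal{D}$ in $\mathcal{B}_{Y|X}$ is denoted $\delta(z_2,z_4)$. For $l\in\mathbb{Z}_{\ge 0}$, $\mathcal{I}_{1l}$ is the left ideal of $\mathcal{D}$ generated by $$z_1\tfrac{\partial}{\partial z_1}-l,\quad \tfrac{\partial^{l+1}}{\partial z_1^{l+1}},\quad z_2\tfrac{\partial}{\partial z_2}+l+1,\quad z_2^{l+1},\quad \tfrac{\partial}{\partial z_3},\quad z_4,$$ and $\mathcal{M}_{1l}:=\mathcal{D}/\mathcal{I}_{1l}$. $\mathcal{I}_3$ is the left ideal of $\mathcal{D}$ generated by $$z_1\tfrac{\partial}{\partial z_1}+z_2\tfrac{\partial}{\partial z_2}+1,\quad \tfrac{\partial}{\partial z_3},\quad z_4,$$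 and $\mathcal{M}_3:=\mathcal{D}/\mathcal{I}_3$. A simple holonomic system is a holonomic left $\mathcal{D}$-module that is simple. *)

theory Defs
  imports
    "HOL-Algebra.AbelCoset"
    "HOL-Algebra.Module"
    "HOL-Algebra.Generated_Rings"
    "HOL-Library.Poly_Mapping"
    "HOL-Library.Cardinality"
    "HOL-Computational_Algebra.Polynomial"
begin

section \<open>Left modules over a (noncommutative) ring\<close>

text \<open>The locale \<^locale>\<open>module\<close> of the library demands a commutative ring of scalars. Left
  modules are the same records without that demand; as there, the fields \<open>mult\<close> and \<open>one\<close> of the
  module record carry no meaning. The library's \<^locale>\<open>submodule\<close> does not use commutativity.\<close>

locale left_module = R?: ring R + M?: abelian_group M
    for R :: "('a, 'k) ring_scheme" (structure) and M :: "('a, 'b, 'm) module_scheme" (structure) +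
  assumes smult_closed:
      "\<lbrakk>a \<in> carrier R; x \<in> carrier M\<rbrakk> \<Longrightarrow> a \<odot>\<^bsub>M\<^esub> x \<in> carrier M"
    and smult_l_distr:
      "\<lbrakk>a \<in> carrier R; b \<in> carrier R; x \<in> carrier M\<rbrakk>
        \<Longrightarrow> (a \<oplus> b) \<odot>\<^bsub>M\<^esub> x = a \<odot>\<^bsub>M\<^esub> x \<oplus>\<^bsub>M\<^esub> b \<odot>\<^bsub>M\<^esub> x"
    and smult_r_distr:
      "\<lbrakk>a \<in> carrier R; x \<in> carrier M; y \<in> carrier M\<rbrakk>
        \<Longrightarrow> a \<odot>\<^bsub>M\<^esub> (x \<oplus>\<^bsub>M\<^esub> y) = a \<odot>\<^bsub>M\<^esub> x \<oplus>\<^bsub>M\<^esub> a \<odot>\<^bsub>M\<^esub> y"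
    and smult_assoc1:
      "\<lbrakk>a \<in> carrier R; b \<in> carrier R; x \<in> carrier M\<rbrakk>
        \<Longrightarrow> (a \<otimes> b) \<odot>\<^bsub>M\<^esub> x = a \<odot>\<^bsub>M\<^esub> (b \<odot>\<^bsub>M\<^esub> x)"
    and smult_one:
      "x \<in> carrier M \<Longrightarrow> \<one> \<odot>\<^bsub>M\<^esub> x = x"

definition left_module_hom ::
    "('a, 'k) ring_scheme \<Rightarrow> ('a, 'b, 'm) module_scheme \<Rightarrow> ('a, 'c, 'n) module_scheme \<Rightarrow> ('b \<Rightarrow> 'c) set"
  where "left_module_hom R M N =
    {f \<in> carrier M \<rightarrow> carrier N.
       (\<forall>x\<in>carrier M. \<forall>y\<in>carrier M. f (x \<oplus>\<^bsub>M\<^esub> y) = f x \<oplus>\<^bsub>N\<^esub> f y) \<and>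
       (\<forall>a\<in>carrier R. \<forall>x\<in>carrier M. f (a \<odot>\<^bsub>M\<^esub> x) = a \<odot>\<^bsub>N\<^esub> f x)}"

definition left_module_iso ::
    "('a, 'k) ring_scheme \<Rightarrow> ('a, 'b, 'm) module_scheme \<Rightarrow> ('a, 'c, 'n) module_scheme \<Rightarrow> ('b \<Rightarrow> 'c) set"
  where "left_module_iso R M N =
    {f \<in> left_module_hom R M N. bij_betw f (carrier M) (carrier N)}"

definition simple_left_module :: "('a, 'k) ring_scheme \<Rightarrow> ('a, 'b, 'm) module_scheme \<Rightarrow> bool"
  where "simple_left_module R M \<longleftrightarrow>
    left_module R M \<and> carrier M \<noteq> {\<zero>\<^bsub>M\<^esub>} \<and>
    (\<forall>N. submodule N R M \<longrightarrow> N = {\<zero>\<^bsub>M\<^esub>} \<or> N = carrier M)"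

definition left_ideal :: "'a set \<Rightarrow> ('a, 'k) ring_scheme \<Rightarrow> bool"
  where "left_ideal I R \<longleftrightarrow>
    additive_subgroup I R \<and> (\<forall>a\<in>carrier R. \<forall>x\<in>I. a \<otimes>\<^bsub>R\<^esub> x \<in> I)"

definition left_ideal_gen :: "('a, 'k) ring_scheme \<Rightarrow> 'a set \<Rightarrow> 'a set"
  where "left_ideal_gen R S = \<Inter>{I. left_ideal I R \<and> S \<subseteq> I}"

text \<open>The left module \<open>R/I\<close> of a left ideal \<open>I\<close>; the class of \<open>r\<close> is the coset \<open>I +>\<^bsub>R\<^esub> r\<close>.\<close>

definition quotient_left_module :: "('a, 'k) ring_scheme \<Rightarrow> 'a set \<Rightarrow> ('a, 'a set) module"
  where "quotient_left_module R I =
    \<lparr>carrier = a_rcosets\<^bsub>R\<^esub> I, monoid.mult = undefined, one = undefined,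
     zero = I, add = set_add R,
     module.smult = (\<lambda>r X. \<Union>x\<in>X. I +>\<^bsub>R\<^esub> (r \<otimes>\<^bsub>R\<^esub> x))\<rparr>"

definition direct_sum_module :: "'i set \<Rightarrow> ('i \<Rightarrow> ('a, 'b, 'm) module_scheme) \<Rightarrow> ('a, 'i \<Rightarrow> 'b) module"
  where "direct_sum_module J M =
    \<lparr>carrier = {f \<in> \<Pi>\<^sub>E j\<in>J. carrier (M j). finite {j \<in> J. f j \<noteq> \<zero>\<^bsub>M j\<^esub>}},
     monoid.mult = undefined, one = undefined,
     zero = (\<lambda>j\<in>J. \<zero>\<^bsub>M j\<^esub>), add = (\<lambda>f g. \<lambda>j\<in>J. f j \<oplus>\<^bsub>M j\<^esub> g j),
     module.smult = (\<lambda>r f. \<lambda>j\<in>J. r \<odot>\<^bsub>M j\<^esub> f j)\<rparr>"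


section \<open>The Weyl algebra\<close>

text \<open>Complex polynomials in variables indexed by \<open>'v\<close>, as finitely supported functions from
  exponent vectors to coefficients.\<close>

type_synonym 'v cpoly = "('v \<Rightarrow>\<^sub>0 nat) \<Rightarrow>\<^sub>0 complex"

type_synonym 'v pop = "'v cpoly \<Rightarrow> 'v cpoly"

definition scalar_op :: "complex \<Rightarrow> 'v pop"
  where "scalar_op c = (\<lambda>p. Poly_Mapping.single 0 c * p)"

definition var_op :: "'v \<Rightarrow> 'v pop"
  where "var_op v = (\<lambda>p. Poly_Mapping.single (Poly_Mapping.single v 1) 1 * p)"

text \<open>In the next sum, a monomial \<open>m\<close> free of \<open>v\<close> contributes 0, so that truncated subtraction on
  exponents does no harm.\<close>

definition partial_op :: "'v \<Rightarrow> 'v pop"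
  where "partial_op v = (\<lambda>p. \<Sum>m\<in>Poly_Mapping.keys p.
    Poly_Mapping.single (m - Poly_Mapping.single v 1)
      (of_nat (Poly_Mapping.lookup m v) * Poly_Mapping.lookup p m))"

definition linear_op_ring :: "'v pop ring"
  where "linear_op_ring =
    \<lparr>carrier = {F. (\<forall>p q. F (p + q) = F p + F q) \<and>
                   (\<forall>c p. F (scalar_op c p) = scalar_op c (F p))},
     monoid.mult = (\<circ>), one = id, zero = (\<lambda>_. 0), add = (\<lambda>F G p. F p + G p)\<rparr>"

text \<open>Over the complex numbers, the algebra of differential operators with polynomial
  coefficients is the subalgebra of all linear operators on polynomials that is generated by the
  variables and the partial derivatives.\<close>

definition weyl_algebra :: "'v pop ring"
  where "weyl_algebra = linear_op_ring
    \<lparr>carrier := generate_ring linear_op_ring (range scalar_op \<union> range var_op \<union> range partial_op)\<rparr>"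


section \<open>Holonomic modules\<close>

text \<open>\<open>bernstein k\<close> is the complex span of the normally ordered monomials
  \<open>z\<^sup>\<alpha> \<partial>\<^sup>\<beta>\<close> of total degree \<open>\<bar>\<alpha>\<bar> + \<bar>\<beta>\<bar> \<le> k\<close>. The exponents are encoded by lists of
  variables: \<open>vs\<close> stands for the product of the \<open>z\<^sub>v\<close>, \<open>v\<close> in \<open>vs\<close>, and \<open>ws\<close> for the product of the
  \<open>\<partial>\<^sub>w\<close>, \<open>w\<close> in \<open>ws\<close>.\<close>

definition normal_monomial :: "'v list \<Rightarrow> 'v list \<Rightarrow> 'v pop"
  where "normal_monomial vs ws =
    foldr (\<circ>) (map var_op vs) id \<circ> foldr (\<circ>) (map partial_op ws) id"

definition bernstein :: "nat \<Rightarrow> 'v pop set"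
  where "bernstein k = generate (add_monoid weyl_algebra)
    {scalar_op c \<circ> normal_monomial vs ws |c vs ws. length vs + length ws \<le> k}"

text \<open>\<open>complex_dim M V d\<close>: the subset \<open>V\<close> of the module \<open>M\<close> is a complex subspace of dimension \<open>d\<close>,
  i.e. it consists of the combinations of some \<open>d\<close>-element set, with unique coefficients.\<close>

definition complex_dim :: "('v pop, 'b, 'm) module_scheme \<Rightarrow> 'b set \<Rightarrow> nat \<Rightarrow> bool"
  where "complex_dim M V d \<longleftrightarrow>
    (\<exists>B. finite B \<and> card B = d \<and> B \<subseteq> carrier M \<and>
       bij_betw (\<lambda>c. \<Oplus>\<^bsub>M\<^esub>b\<in>B. scalar_op (c b) \<odot>\<^bsub>M\<^esub> b) (B \<rightarrow>\<^sub>E UNIV) V)"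

definition bernstein_prod :: "('v pop, 'b, 'm) module_scheme \<Rightarrow> nat \<Rightarrow> 'b set \<Rightarrow> 'b set"
  where "bernstein_prod M i V =
    generate (add_monoid M) {P \<odot>\<^bsub>M\<^esub> x |P x. P \<in> bernstein i \<and> x \<in> V}"

definition good_filtration :: "('v pop, 'b, 'm) module_scheme \<Rightarrow> (nat \<Rightarrow> 'b set) \<Rightarrow> bool"
  where "good_filtration M \<Gamma> \<longleftrightarrow>
    (\<forall>k. \<exists>d. complex_dim M (\<Gamma> k) d) \<and>
    (\<forall>k. \<Gamma> k \<subseteq> \<Gamma> (Suc k)) \<and> (\<Union>k. \<Gamma> k) = carrier M \<and>
    (\<forall>i k. bernstein_prod M i (\<Gamma> k) \<subseteq> \<Gamma> (i + k)) \<and>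
    (\<exists>k\<^sub>0. \<forall>k\<ge>k\<^sub>0. \<forall>i. bernstein_prod M i (\<Gamma> k) = \<Gamma> (i + k))"

text \<open>Holonomicity in the sense of Bernstein: the module is finitely generated (which the
  existence of a good filtration implies) and it is zero or its dimension, the degree of its
  Hilbert polynomial, is the number of variables. This degree does not depend on the good
  filtration.\<close>

definition holonomic :: "('v::finite pop, 'b, 'm) module_scheme \<Rightarrow> bool"
  where "holonomic M \<longleftrightarrow>
    left_module weyl_algebra M \<and>
    (carrier M = {\<zero>\<^bsub>M\<^esub>} \<or>
     (\<exists>\<Gamma> \<chi> :: real poly. good_filtration M \<Gamma> \<and>
        (\<forall>\<^sub>F k in sequentially. \<exists>d. complex_dim M (\<Gamma> k) d \<and> real d = poly \<chi> (real k)) \<and>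
        degree \<chi> = CARD('v)))"

definition simple_holonomic :: "('v::finite pop, 'b, 'm) module_scheme \<Rightarrow> bool"
  where "simple_holonomic M \<longleftrightarrow> holonomic M \<and> simple_left_module weyl_algebra M"


section \<open>The modules on four-dimensional space\<close>

datatype coord = Z1 | Z2 | Z3 | Z4

instance coord :: finite
proof
  have "(UNIV :: coord set) = {Z1, Z2, Z3, Z4}"
    using coord.exhaust by blast
  then show "finite (UNIV :: coord set)"
    by (metis finite.emptyI finite.insertI)
qed

abbreviation D4 :: "coord pop ring" (\<open>\<D>\<close>)
  where "\<D> \<equiv> weyl_algebra"

abbreviation zvar :: "coord \<Rightarrow> coord pop"
  where "zvar \<equiv> var_op"

abbreviation pd :: "coord \<Rightarrow> coord pop" (\<open>\<partial>\<close>)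
  where "\<partial> \<equiv> partial_op"

definition B_YX :: "(coord pop, coord pop set) module"
  where "B_YX = quotient_left_module \<D> (left_ideal_gen \<D> {\<partial> Z1, zvar Z2, \<partial> Z3, zvar Z4})"

definition delta :: "coord pop set" (\<open>\<delta>\<close>)
  where "\<delta> = left_ideal_gen \<D> {\<partial> Z1, zvar Z2, \<partial> Z3, zvar Z4} +>\<^bsub>\<D>\<^esub> \<one>\<^bsub>\<D>\<^esub>"

definition I1 :: "nat \<Rightarrow> coord pop set"
  where "I1 l = left_ideal_gen \<D>
    {zvar Z1 \<otimes>\<^bsub>\<D>\<^esub> \<partial> Z1 \<ominus>\<^bsub>\<D>\<^esub> scalar_op (of_nat l),
     \<partial> Z1 [^]\<^bsub>\<D>\<^esub> (l + 1),
     zvar Z2 \<otimes>\<^bsub>\<D>\<^esub> \<partial> Z2 \<oplus>\<^bsub>\<D>\<^esub> scalar_op (of_nat (l + 1)),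
     zvar Z2 [^]\<^bsub>\<D>\<^esub> (l + 1),
     \<partial> Z3,
     zvar Z4}"

definition M1 :: "nat \<Rightarrow> (coord pop, coord pop set) module"
  where "M1 l = quotient_left_module \<D> (I1 l)"

definition I3 :: "coord pop set"
  where "I3 = left_ideal_gen \<D>
    {zvar Z1 \<otimes>\<^bsub>\<D>\<^esub> \<partial> Z1 \<oplus>\<^bsub>\<D>\<^esub> zvar Z2 \<otimes>\<^bsub>\<D>\<^esub> \<partial> Z2 \<oplus>\<^bsub>\<D>\<^esub> \<one>\<^bsub>\<D>\<^esub>, \<partial> Z3, zvar Z4}"

definition M3 :: "(coord pop, coord pop set) module"
  where "M3 = quotient_left_module \<D> I3"

end

theory Submission
  imports Defs
begin

text \<open>
  Up to a partial Fourier transform the module \<open>\<B>\<^bsub>Y|X\<^esub>\<close> is the polynomial ring. Its generator \<open>\<delta>\<close>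
  is a vacuum vector: it is killed by \<open>\<partial>\<^sub>1, z\<^sub>2, \<partial>\<^sub>3, z\<^sub>4\<close>, while the operators
  \<open>z\<^sub>1, \<partial>\<^sub>2, z\<^sub>3, \<partial>\<^sub>4\<close> commute with each other. For an arbitrary finite set of variables
  and a set \<open>F\<close> of variables to be transformed, the creation operators (\<open>\<partial>\<^sub>v\<close> for \<open>v \<in> F\<close>, otherwise
  \<open>z\<^sub>v\<close>) and the annihilation operators (\<open>-z\<^sub>v\<close> for \<open>v \<in> F\<close>, otherwise \<open>\<partial>\<^sub>v\<close>) satisfy the
  commutation relations of the \<open>z\<^sub>v\<close> and \<open>\<partial>\<^sub>v\<close>. Hence, if \<open>e\<close> is killed by all annihilation
  operators, the map \<open>p \<mapsto> p(creation) e\<close> on polynomials turns multiplication by \<open>z\<^sub>v\<close> into creation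
  and \<open>\<partial>/\<partial>z\<^sub>v\<close> into annihilation. A nonzero polynomial can be differentiated down to a nonzero
  constant (\<open>differentiation_closed_contains_1\<close>); therefore a module generated by such an
  \<open>e \<noteq> 0\<close> is simple and the map is a bijection. The images of the polynomials of degree at most
  \<open>k\<close> form a good filtration whose dimension \<open>(k + n) choose n\<close> is a polynomial of degree \<open>n\<close> in \<open>k\<close>,
  \<open>n\<close> being the number of variables. So the module is simple holonomic
  (\<open>cyclic_vacuum.simple_holonomic\<close>).

  The one point that is not formal is that a nonzero vacuum vector exists, in other words that the left
  ideal generated by the annihilation operators is proper (\<open>ex_proper_left_ideal_vacuum\<close>). Morally
  the vacuum vector is the monomial with exponent \<open>-1\<close> at the variables in \<open>F\<close> and \<open>0\<close> elsewhere,
  taken modulo monomials that are regular in some variable of \<open>F\<close>. Operators act on polynomials only, but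
  their coefficients on the family of monomials \<open>z\<^sup>s z\<^sup>(\<^sup>m\<^sup>,\<^sup>\<dots>\<^sup>,\<^sup>m\<^sup>)\<close> are polynomials in \<open>m\<close>, and
  these can be evaluated at \<open>m = -1\<close>.

  For \<open>\<M>\<^sub>1\<^sub>l\<close> put \<open>A = (z\<^sub>1\<partial>\<^sub>2)\<^sup>l\<close> and \<open>C = \<partial>\<^sub>1\<^sup>l z\<^sub>2\<^sup>l\<close>. Right multiplication by \<open>A\<close> maps the ideal
  of \<open>\<M>\<^sub>1\<^sub>l\<close> into the one of \<open>\<B>\<^bsub>Y|X\<^esub>\<close>, right multiplication by \<open>C\<close> maps back, and both \<open>A C\<close>
  and \<open>C A\<close> are congruent to the nonzero constant \<open>(-1)\<^sup>l (l!)\<^sup>2\<close> modulo the respective ideal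
  (\<open>fwd_bwd_op\<close>, \<open>bwd_fwd_op\<close>). This gives the isomorphism of (i), and it shows that the class of \<open>C\<close>
  is a nonzero vacuum vector that generates \<open>\<M>\<^sub>1\<^sub>l\<close>. Part (ii) holds because the first generator of
  \<open>\<I>\<^sub>3\<close> is the sum of the first and the third generator of \<open>\<I>\<^sub>1\<^sub>l\<close>. For (iii), the
  Euler operator \<open>z\<^sub>1\<partial>\<^sub>1\<close> acts on the generator of \<open>\<M>\<^sub>1\<^sub>l\<close> by the scalar \<open>l\<close>; as these scalars are
  distinct, Lagrange interpolation polynomials in \<open>z\<^sub>1\<partial>\<^sub>1\<close> separate the summands
  (\<open>I1_separating_operator\<close>).
\<close>


section \<open>Polynomials and their partial derivatives\<close>

abbreviation lookup :: "('a \<Rightarrow>\<^sub>0 'b::zero) \<Rightarrow> 'a \<Rightarrow> 'b"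
  where "lookup \<equiv> Poly_Mapping.lookup"

abbreviation single :: "'a \<Rightarrow> 'b \<Rightarrow> ('a \<Rightarrow>\<^sub>0 'b::zero)"
  where "single \<equiv> Poly_Mapping.single"

abbreviation keys :: "('a \<Rightarrow>\<^sub>0 'b::zero) \<Rightarrow> 'a set"
  where "keys \<equiv> Poly_Mapping.keys"

text \<open>The exponent vector of a single variable is written with the numeral \<open>1\<close>. Rewriting this numeral to
  \<open>Suc 0\<close> would keep the rules about such vectors from matching.\<close>

declare One_nat_def [simp del]

abbreviation unit_exp :: "'v \<Rightarrow> ('v \<Rightarrow>\<^sub>0 nat)"
  where "unit_exp v \<equiv> single v 1"

text \<open>Both partial derivatives and the substitution of operators for variables are defined by sums over
  the support; this is why they are additive, although the support of a sum can shrink.\<close>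

lemma sum_keys_add:
  fixes g :: "'a \<Rightarrow> 'b::monoid_add \<Rightarrow> 'c::comm_monoid_add"
  assumes "\<And>a. g a 0 = 0" and "\<And>a x y. g a (x + y) = g a x + g a y"
  shows "(\<Sum>a\<in>keys (p + q). g a (lookup (p + q) a)) =
    (\<Sum>a\<in>keys p. g a (lookup p a)) +
    (\<Sum>a\<in>keys q. g a (lookup q a))"
proof -
  let ?A = "keys p \<union> keys q"
  have ext: "(\<Sum>a\<in>keys r. g a (lookup r a)) =
      (\<Sum>a\<in>?A. g a (lookup r a))" if "keys r \<subseteq> ?A" for r
    using that by (intro sum.mono_neutral_left) (auto simp: assms(1) in_keys_iff)
  show ?thesis
    by (subst (1 2 3) ext) (simp_all add: keys_add lookup_add assms(2) sum.distrib)
qed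

lemma sum_single_keys:
  fixes p :: "'a \<Rightarrow>\<^sub>0 'b::comm_monoid_add"
  shows "(\<Sum>a\<in>keys p. single a (lookup p a)) = p"
  by (rule poly_mapping_eqI)
    (auto simp: lookup_sum lookup_single when_def in_keys_iff if_distrib cong: if_cong)

lemma poly_mapping_single_add_induct [case_names single add]:
  fixes p :: "'a \<Rightarrow>\<^sub>0 'b::comm_monoid_add"
  assumes single: "\<And>a c. Q (single a c)"
    and add: "\<And>p q. Q p \<Longrightarrow> Q q \<Longrightarrow> Q (p + q)"
  shows "Q p"
proof -
  have "Q (\<Sum>a\<in>A. single a (lookup p a))" if "finite A" for A
    using that
  proof induction
    case empty
    show ?case using single[of undefined 0] by simp
  qed (simp add: single add)
  from this[of "keys p"] show ?thesis by (simp add: sum_single_keys)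
qed

lemma exponent_induct [case_names zero unit]:
  fixes a :: "'v \<Rightarrow>\<^sub>0 nat"
  assumes zero: "Q 0" and unit: "\<And>v a. Q a \<Longrightarrow> Q (unit_exp v + a)"
  shows "Q a"
proof -
  have *: "Q (single v k + b)" if "Q b" for v k and b :: "'v \<Rightarrow>\<^sub>0 nat"
  proof (induction k)
    case (Suc k)
    have "single v (Suc k) + b = unit_exp v + (single v k + b)"
      using single_add[of v 1 k] by (simp only: plus_1_eq_Suc add.assoc)
    then show ?case using unit[OF Suc] by simp
  qed (simp add: that)
  have "\<forall>b. Q b \<longrightarrow> Q (a + b)"
    by (induction a rule: poly_mapping_single_add_induct) (auto simp: * add.assoc)
  then show ?thesis using zero by force
qed

lemma var_op_single: "var_op v (single a c) = single (unit_exp v + a) c"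
  by (simp add: var_op_def mult_single)

lemma var_op_add: "var_op v (p + q) = var_op v p + var_op v q"
  by (simp add: var_op_def distrib_left)

lemma scalar_op_single: "scalar_op b (single a c) = single a (b * c)"
  by (simp add: scalar_op_def mult_single)

lemma scalar_op_add: "scalar_op b (p + q) = scalar_op b p + scalar_op b q"
  by (simp add: scalar_op_def distrib_left)

lemma scalar_op_0 [simp]: "scalar_op 0 = (\<lambda>_. 0)"
  by (simp add: scalar_op_def)

lemma scalar_op_1 [simp]: "scalar_op 1 = id"
  by (simp add: scalar_op_def fun_eq_iff)

lemma scalar_op_minus_1: "scalar_op (-1) = uminus"
  by (simp add: scalar_op_def fun_eq_iff single_uminus)

lemma scalar_op_uminus: "scalar_op (- c) p = - scalar_op c p"
  by (simp add: scalar_op_def fun_eq_iff single_uminus)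

lemma scalar_op_plus: "scalar_op (b + c) p = scalar_op b p + scalar_op c p"
  by (simp add: scalar_op_def single_add distrib_right)

lemma scalar_op_scalar_op: "scalar_op b (scalar_op c p) = scalar_op (b * c) p"
  by (simp add: scalar_op_def mult.assoc[symmetric] mult_single)

text \<open>Polynomials are generated from \<open>1\<close> by the operations that the identities below are about, so that an
  induction along this rule reduces an identity to commutation relations.\<close>

lemma cpoly_induct [case_names one scalar var add]:
  fixes p :: "'v cpoly"
  assumes one: "Q 1" and scalar: "\<And>c p. Q p \<Longrightarrow> Q (scalar_op c p)"
    and var: "\<And>v p. Q p \<Longrightarrow> Q (var_op v p)" and add: "\<And>p q. Q p \<Longrightarrow> Q q \<Longrightarrow> Q (p + q)"
  shows "Q p"
proof (induction p rule: poly_mapping_single_add_induct)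
  case (single a c)
  have "Q (single a 1)"
  proof (induction a rule: exponent_induct)
    case (unit v a)
    then show ?case using var[of "single a 1" v] by (simp add: var_op_single)
  qed (simp add: one)
  from scalar[OF this, of c] show ?case by (simp add: scalar_op_single)
qed (rule add)

lemma partial_op_add: "partial_op v (p + q) = partial_op v p + partial_op v q"
  unfolding partial_op_def
  by (rule sum_keys_add[where g = "\<lambda>m x. single (m - unit_exp v)
        (of_nat (lookup m v) * x)"])
    (simp_all add: distrib_left single_add)

lemma partial_op_single:
  "partial_op v (single a c) =
    single (a - unit_exp v) (of_nat (lookup a v) * c)"
  by (cases "c = 0") (simp_all add: partial_op_def)

lemma scalar_op_commute_var: "scalar_op c (var_op v p) = var_op v (scalar_op c p)"
  by (simp add: scalar_op_def var_op_def mult.left_commute)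

lemma scalar_op_commute_partial: "scalar_op c (partial_op v p) = partial_op v (scalar_op c p)"
  by (induction p rule: poly_mapping_single_add_induct)
    (simp_all add: partial_op_single scalar_op_single scalar_op_add partial_op_add mult.left_commute)

lemma var_op_commute: "var_op u (var_op v p) = var_op v (var_op u p)"
  by (simp add: var_op_def mult.left_commute)

lemma unit_exp_diff_add: "lookup a v > 0 \<Longrightarrow> unit_exp v + (a - unit_exp v) = a"
  by (rule poly_mapping_eqI) (auto simp: lookup_add lookup_minus lookup_single when_def)

lemma partial_op_commute: "partial_op u (partial_op v p) = partial_op v (partial_op u p)"
proof (induction p rule: poly_mapping_single_add_induct)
  case (single a c)
  show ?case
    by (cases "u = v")
      (simp_all add: partial_op_single lookup_minus lookup_single when_def diff_diff_eq add.commute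
        mult.left_commute)
qed (simp add: partial_op_add)

text \<open>The canonical commutation relation.\<close>

lemma partial_op_var_op:
  "partial_op u (var_op v p) = var_op v (partial_op u p) + (if u = v then p else 0)"
proof (induction p rule: poly_mapping_single_add_induct)
  case (single a c)
  have "single (unit_exp v + a - unit_exp u) (of_nat (lookup a u) * c) =
      single (unit_exp v + (a - unit_exp u)) (of_nat (lookup a u) * c)"
  proof (cases "lookup a u")
    case (Suc n)
    have "unit_exp v + a - unit_exp u = unit_exp v + (a - unit_exp u)"
      by (rule poly_mapping_eqI) (use Suc in \<open>auto simp: lookup_add lookup_minus lookup_single when_def\<close>)
    then show ?thesis by simp
  qed simp
  then show ?case
    by (auto simp: var_op_single partial_op_single lookup_add lookup_single when_def distrib_right single_add)
qed (simp add: var_op_add partial_op_add)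

lemma partial_op_1 [simp]: "partial_op v 1 = 0"
  using partial_op_single[of v 0 1] by simp

lemma lookup_var_op:
  "lookup (var_op v p) a =
    (if lookup a v = 0 then 0 else lookup p (a - unit_exp v))"
proof (induction p rule: poly_mapping_single_add_induct)
  case (single b c)
  have "unit_exp v + b = a \<longleftrightarrow> lookup a v \<noteq> 0 \<and> b = a - unit_exp v"
    by (auto simp: lookup_add unit_exp_diff_add)
  then show ?case by (auto simp: var_op_single lookup_single when_def)
qed (simp add: var_op_add lookup_add)

lemma lookup_partial_op:
  "lookup (partial_op v p) a =
    of_nat (Suc (lookup a v)) * lookup p (unit_exp v + a)"
proof (induction p rule: poly_mapping_single_add_induct)
  case (single b c)
  have "b - unit_exp v = a \<longleftrightarrow> b = unit_exp v + a" if "lookup b v \<noteq> 0"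
    using that unit_exp_diff_add[of b v] by auto
  then show ?case
    by (cases "lookup b v = 0")
      (auto simp: partial_op_single lookup_single when_def lookup_add)
qed (simp add: partial_op_add lookup_add distrib_left)

lemma lookup_scalar_op: "lookup (scalar_op c p) a = c * lookup p a"
  by (induction p rule: poly_mapping_single_add_induct)
    (auto simp: scalar_op_single scalar_op_add lookup_add lookup_single when_def distrib_left)

definition exp_size :: "('v::finite \<Rightarrow>\<^sub>0 nat) \<Rightarrow> nat"
  where "exp_size a = (\<Sum>v\<in>UNIV. lookup a v)"

lemma exp_size_add: "exp_size (a + b) = exp_size a + exp_size b"
  by (simp add: exp_size_def lookup_add sum.distrib)

lemma exp_size_0 [simp]: "exp_size 0 = 0"
  by (simp add: exp_size_def)

lemma exp_size_unit [simp]: "exp_size (unit_exp v) = 1"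
  by (simp add: exp_size_def lookup_single when_def)

lemma exp_size_eq_0: "exp_size a = 0 \<longleftrightarrow> a = 0"
  by (auto simp: exp_size_def poly_mapping_eq_iff fun_eq_iff)

definition polys_upto :: "nat \<Rightarrow> ('v::finite) cpoly set"
  where "polys_upto k = {p. \<forall>a\<in>keys p. exp_size a \<le> k}"

lemma polys_upto_iff: "p \<in> polys_upto k \<longleftrightarrow> (\<forall>a. k < exp_size a \<longrightarrow> lookup p a = 0)"
  by (auto simp: polys_upto_def in_keys_iff not_le[symmetric])

text \<open>A nonzero polynomial can be differentiated down to a nonzero constant: as long as some
  derivative is nonzero it has smaller degree, and otherwise the polynomial is constant. In other
  words, \<open>\<complex>[z]\<close> is a simple module over the differential operators.\<close>

lemma differentiation_closed_contains_1:
  fixes K :: "('v::finite) cpoly set"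
  assumes scalar: "\<And>c p. p \<in> K \<Longrightarrow> scalar_op c p \<in> K" and diff: "\<And>v p. p \<in> K \<Longrightarrow> partial_op v p \<in> K"
    and "p \<in> K" "p \<noteq> 0"
  shows "1 \<in> K"
proof -
  have ex: "\<exists>k. p \<in> polys_upto k" for p :: "'v cpoly"
  proof
    show "p \<in> polys_upto (\<Sum>a\<in>keys p. exp_size a)"
      unfolding polys_upto_def using member_le_sum[of _ "keys p" exp_size] by auto
  qed
  have "\<forall>p\<in>K. p \<in> polys_upto k \<longrightarrow> p \<noteq> 0 \<longrightarrow> 1 \<in> K" for k
  proof (induction k)
    case 0
    show ?case
    proof (intro ballI impI)
      fix p assume p: "p \<in> K" "p \<in> polys_upto 0" "p \<noteq> 0"
      have z: "lookup p a = 0" if "a \<noteq> 0" for a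
        using p(2) that exp_size_eq_0[of a] by (simp add: polys_upto_iff)
      have pc: "p = single 0 (lookup p 0)"
        by (rule poly_mapping_eqI) (simp add: lookup_single when_def z)
      with p(3) have "lookup p 0 \<noteq> 0" by force
      with pc have "scalar_op (inverse (lookup p 0)) p = 1"
        by (metis left_inverse scalar_op_single single_one)
      with scalar[OF p(1)] show "1 \<in> K" by metis
    qed
  next
    case (Suc k)
    show ?case
    proof (intro ballI impI)
      fix p assume p: "p \<in> K" "p \<in> polys_upto (Suc k)" "p \<noteq> 0"
      show "1 \<in> K"
      proof (cases "\<exists>v. partial_op v p \<noteq> 0")
        case True
        then obtain v where v: "partial_op v p \<noteq> 0" by blast
        have "partial_op v p \<in> polys_upto k"
          unfolding polys_upto_iff
        proof (intro allI impI)
          fix a :: "'v \<Rightarrow>\<^sub>0 nat" assume "k < exp_size a"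
          then have "Suc k < exp_size (unit_exp v + a)" by (simp only: exp_size_add exp_size_unit plus_1_eq_Suc Suc_less_eq)
          then have "lookup p (unit_exp v + a) = 0" using p(2) by (simp only: polys_upto_iff)
          then show "lookup (partial_op v p) a = 0" by (simp only: lookup_partial_op mult_zero_right)
        qed
        from Suc[rule_format, OF diff[OF p(1)] this v] show ?thesis .
      next
        case False
        have "lookup p a = 0" if nz: "exp_size a \<noteq> 0" for a
        proof -
          obtain v where "lookup a v \<noteq> 0"
            by (rule sum.not_neutral_contains_not_neutral[OF nz[unfolded exp_size_def]])
          then have v: "lookup a v > 0" by simp
          have "lookup (partial_op v p) (a - unit_exp v) = 0" using False by simp
          then show ?thesis
            unfolding lookup_partial_op unit_exp_diff_add[OF v] using of_nat_neq_0 by (metis mult_eq_0_iff)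
        qed
        then have "p \<in> polys_upto k" by (auto simp: polys_upto_iff)
        from Suc[rule_format, OF p(1) this p(3)] show ?thesis .
      qed
    qed
  qed
  then show ?thesis using ex[of p] assms(3,4) by metis
qed


section \<open>The Weyl algebra as a ring\<close>

lemma linear_op_ring_carrier:
  "F \<in> carrier linear_op_ring \<longleftrightarrow>
    (\<forall>p q. F (p + q) = F p + F q) \<and> (\<forall>c p. F (scalar_op c p) = scalar_op c (F p))"
  by (simp add: linear_op_ring_def)

lemma linear_op_ring_is_ring: "ring (linear_op_ring :: 'v pop ring)"
proof (rule ringI)
  show "abelian_group (linear_op_ring :: 'v pop ring)"
  proof (rule abelian_groupI)
    fix F :: "'v pop" assume F: "F \<in> carrier linear_op_ring"
    have "(\<lambda>p. - F p) \<in> carrier linear_op_ring"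
      using F by (simp add: linear_op_ring_carrier scalar_op_def)
    then show "\<exists>G\<in>carrier linear_op_ring. G \<oplus>\<^bsub>linear_op_ring\<^esub> F = \<zero>\<^bsub>linear_op_ring\<^esub>"
      by (intro bexI[of _ "\<lambda>p. - F p"]) (simp_all add: linear_op_ring_def)
  qed (auto simp: linear_op_ring_def scalar_op_def distrib_left fun_eq_iff algebra_simps)
  show "monoid (linear_op_ring :: 'v pop ring)"
    by (rule monoidI) (auto simp: linear_op_ring_def fun_eq_iff)
qed (auto simp: linear_op_ring_def fun_eq_iff)

lemma weyl_generators: "range scalar_op \<union> range var_op \<union> range partial_op \<subseteq> carrier linear_op_ring"
  by (auto simp: linear_op_ring_carrier scalar_op_add var_op_add partial_op_add
      scalar_op_commute_var scalar_op_commute_partial scalar_op_scalar_op mult.commute)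

lemma weyl_ring: "ring weyl_algebra"
  unfolding weyl_algebra_def by (rule ring.generate_ring_is_ring[OF linear_op_ring_is_ring weyl_generators])

interpretation weyl: ring weyl_algebra
  by (rule weyl_ring)

lemma weyl_ops:
  "P \<otimes>\<^bsub>weyl_algebra\<^esub> Q = P \<circ> Q" "P \<oplus>\<^bsub>weyl_algebra\<^esub> Q = (\<lambda>p. P p + Q p)"
  "\<one>\<^bsub>weyl_algebra\<^esub> = id" "\<zero>\<^bsub>weyl_algebra\<^esub> = (\<lambda>_. 0)"
  by (simp_all add: weyl_algebra_def linear_op_ring_def)

lemma weyl_mem: "scalar_op c \<in> carrier weyl_algebra" "var_op v \<in> carrier weyl_algebra"
    "partial_op v \<in> carrier weyl_algebra"
  by (auto simp: weyl_algebra_def intro: generate_ring.incl)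

lemma weyl_closed:
  assumes "P \<in> carrier weyl_algebra" "Q \<in> carrier weyl_algebra"
  shows "P \<circ> Q \<in> carrier weyl_algebra" "(\<lambda>p. P p + Q p) \<in> carrier weyl_algebra"
  using weyl.m_closed[OF assms] weyl.a_closed[OF assms] by (simp_all add: weyl_ops)

lemma weyl_id: "id \<in> carrier weyl_algebra" and weyl_zero: "(\<lambda>_. 0) \<in> carrier weyl_algebra"
  using weyl.one_closed weyl.zero_closed by (simp_all add: weyl_ops)

lemma weyl_linear:
  assumes "P \<in> carrier weyl_algebra"
  shows "P (p + q) = P p + P q" "P (scalar_op c p) = scalar_op c (P p)"
  using ring.generate_ring_in_carrier[OF linear_op_ring_is_ring weyl_generators] assms
  by (force simp: weyl_algebra_def linear_op_ring_carrier)+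

lemma weyl_apply_0: "P \<in> carrier weyl_algebra \<Longrightarrow> P 0 = 0"
  using weyl_linear(1)[of P 0 0] by simp

lemma weyl_apply_uminus: "P \<in> carrier weyl_algebra \<Longrightarrow> P (- p) = - P p"
  using weyl_linear(2)[of P "-1" p] by (simp add: scalar_op_minus_1)

lemma weyl_apply_diff: "P \<in> carrier weyl_algebra \<Longrightarrow> P (p - q) = P p - P q"
  using weyl_linear(1)[of P p "- q"] by (simp add: weyl_apply_uminus)

lemma weyl_uminus: "P \<in> carrier weyl_algebra \<Longrightarrow> \<ominus>\<^bsub>weyl_algebra\<^esub> P = (\<lambda>p. - P p)"
proof (rule weyl.minus_equality)
  assume P: "P \<in> carrier weyl_algebra"
  have "scalar_op (-1) \<circ> P = (\<lambda>p. - P p)" by (simp add: scalar_op_minus_1 fun_eq_iff)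
  then show "(\<lambda>p. - P p) \<in> carrier weyl_algebra"
    using weyl_closed(1)[OF weyl_mem(1)[of "-1"] P] by simp
qed (simp_all add: weyl_ops)

lemma weyl_minus:
  "Q \<in> carrier weyl_algebra \<Longrightarrow> P \<ominus>\<^bsub>weyl_algebra\<^esub> Q = (\<lambda>p. P p - Q p)"
  by (simp add: a_minus_def weyl_uminus weyl_ops)

lemma weyl_pow: "P [^]\<^bsub>weyl_algebra\<^esub> (k::nat) = P ^^ k"
  by (induction k) (simp_all add: nat_pow_def weyl_ops funpow_Suc_right del: funpow.simps(2))

lemma weyl_funpow: "P \<in> carrier weyl_algebra \<Longrightarrow> P ^^ k \<in> carrier weyl_algebra"
  using weyl.nat_pow_closed[of P k] by (simp add: weyl_pow)

text \<open>The identity is a scalar and a negative is a composition with the scalar \<open>-1\<close>; therefore the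
  generators, sums and compositions exhaust the algebra.\<close>

lemma weyl_induct [consumes 1, case_names scalar var partial add comp]:
  assumes "P \<in> carrier weyl_algebra"
    and scalar: "\<And>c. Q (scalar_op c)" and var: "\<And>v. Q (var_op v)" and partial: "\<And>v. Q (partial_op v)"
    and add: "\<And>P P'. \<lbrakk>P \<in> carrier weyl_algebra; P' \<in> carrier weyl_algebra; Q P; Q P'\<rbrakk>
      \<Longrightarrow> Q (\<lambda>p. P p + P' p)"
    and comp: "\<And>P P'. \<lbrakk>P \<in> carrier weyl_algebra; P' \<in> carrier weyl_algebra; Q P; Q P'\<rbrakk>
      \<Longrightarrow> Q (P \<circ> P')"
  shows "Q P"
proof -
  let ?G = "range scalar_op \<union> range var_op \<union> range partial_op :: 'a pop set"
  have eq: "carrier weyl_algebra = generate_ring linear_op_ring ?G"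
    by (simp add: weyl_algebra_def)
  from assms(1) show ?thesis unfolding eq
  proof (induction rule: generate_ring.induct)
    case one
    show ?case using scalar[of 1] unfolding scalar_op_1 by (simp only: linear_op_ring_def monoid.simps)
  next
    case (a_inv P)
    have "\<ominus>\<^bsub>linear_op_ring\<^esub> P = scalar_op (-1) \<circ> P"
    proof (rule abelian_group.minus_equality)
      show "abelian_group linear_op_ring" using linear_op_ring_is_ring by (rule ring.is_abelian_group)
      show "P \<in> carrier linear_op_ring" "scalar_op (- 1) \<circ> P \<in> carrier linear_op_ring"
        using a_inv(1) ring.generate_ring_in_carrier[OF linear_op_ring_is_ring weyl_generators]
        by (force simp: linear_op_ring_carrier scalar_op_add scalar_op_scalar_op mult.commute)+
    qed (simp add: linear_op_ring_def scalar_op_minus_1)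
    with comp[OF weyl_mem(1) _ scalar a_inv.IH] a_inv(1) show ?case by (simp only: eq)
  next
    case (eng_add P P')
    moreover have "P \<oplus>\<^bsub>linear_op_ring\<^esub> P' = (\<lambda>p. P p + P' p)" by (simp add: linear_op_ring_def)
    ultimately show ?case using add[of P P'] by (simp only: eq)
  next
    case (eng_mult P P')
    moreover have "P \<otimes>\<^bsub>linear_op_ring\<^esub> P' = P \<circ> P'" by (simp add: linear_op_ring_def)
    ultimately show ?case using comp[of P P'] by (simp only: eq)
  qed (use scalar var partial in blast)
qed


section \<open>Left ideals and cyclic left modules\<close>

lemma (in ring) left_idealI:
  assumes sub: "I \<subseteq> carrier R" and zero: "\<zero> \<in> I" and add: "\<And>x y. \<lbrakk>x \<in> I; y \<in> I\<rbrakk> \<Longrightarrow> x \<oplus> y \<in> I"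
    and mult: "\<And>a x. \<lbrakk>a \<in> carrier R; x \<in> I\<rbrakk> \<Longrightarrow> a \<otimes> x \<in> I"
  shows "left_ideal I R"
  unfolding left_ideal_def
proof (intro conjI ballI)
  show "additive_subgroup I R"
  proof (intro additive_subgroupI add.subgroupI)
    fix x assume x: "x \<in> I"
    have "\<ominus> x = (\<ominus> \<one>) \<otimes> x" using x sub by (simp add: l_minus subset_iff)
    then show "\<ominus> x \<in> I" using mult[OF _ x, of "\<ominus> \<one>"] by simp
  qed (use assms in auto)
qed (use mult in auto)

lemma (in ring) left_ideal_carrier: "left_ideal (carrier R) R"
  by (rule left_idealI) auto

lemma (in ring) left_ideal_left_ideal_gen:
  assumes "S \<subseteq> carrier R"
  shows "left_ideal (left_ideal_gen R S) R"
proof (rule left_idealI)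
  show "left_ideal_gen R S \<subseteq> carrier R"
    using left_ideal_carrier assms by (auto simp: left_ideal_gen_def)
next
  show "\<zero> \<in> left_ideal_gen R S"
    by (auto simp: left_ideal_gen_def left_ideal_def intro: additive_subgroup.zero_closed)
next
  fix x y assume "x \<in> left_ideal_gen R S" "y \<in> left_ideal_gen R S"
  then show "x \<oplus> y \<in> left_ideal_gen R S"
    by (auto simp: left_ideal_gen_def left_ideal_def intro: additive_subgroup.a_closed)
qed (auto simp: left_ideal_gen_def left_ideal_def)

lemma left_ideal_gen_incl: "S \<subseteq> left_ideal_gen R S"
  by (auto simp: left_ideal_gen_def)

lemma left_ideal_gen_least: "\<lbrakk>left_ideal I R; S \<subseteq> I\<rbrakk> \<Longrightarrow> left_ideal_gen R S \<subseteq> I"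
  by (auto simp: left_ideal_gen_def)

lemma (in ring) left_ideal_right_quotient:
  assumes "left_ideal J R" "a \<in> carrier R"
  shows "left_ideal {x \<in> carrier R. x \<otimes> a \<in> J} R"
proof -
  interpret J: additive_subgroup J R using assms(1) by (simp add: left_ideal_def)
  show ?thesis
    by (rule left_idealI) (use assms in \<open>auto simp: left_ideal_def l_distr m_assoc\<close>)
qed

text \<open>Cosets of a left ideal: every statement about the quotient module is transferred to one about
  representatives.\<close>

locale left_ideal_quotient = ring R for R (structure) + fixes I assumes left_ideal: "left_ideal I R"
begin

sublocale I: additive_subgroup I R
  using left_ideal by (simp add: left_ideal_def)

sublocale I: abelian_subgroup I R
  by (rule abelian_subgroupI3[OF I.additive_subgroup_axioms is_abelian_group])

lemma I_mult: "\<lbrakk>a \<in> carrier R; x \<in> I\<rbrakk> \<Longrightarrow> a \<otimes> x \<in> I"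
  using left_ideal by (simp add: left_ideal_def)

lemma carrier_quotient: "carrier (quotient_left_module R I) = (\<lambda>a. I +> a) ` carrier R"
  by (auto simp: quotient_left_module_def A_RCOSETS_def')

lemma zero_quotient: "\<zero>\<^bsub>quotient_left_module R I\<^esub> = I +> \<zero>"
  using a_coset_add_zero[OF I.a_subset] by (simp add: quotient_left_module_def)

lemma coset_eq_iff:
  assumes "a \<in> carrier R" "b \<in> carrier R"
  shows "I +> a = I +> b \<longleftrightarrow> a \<ominus> b \<in> I"
proof -
  have "I +> a = I +> b \<longleftrightarrow> a \<in> I +> b"
    using assms I.a_rcos_self[of a] I.a_repr_independence'[of a b] by auto
  then show ?thesis using I.a_rcos_module_minus[OF ring_axioms assms(2,1)] by simp
qed

lemma coset_eq_zero_iff: "a \<in> carrier R \<Longrightarrow> I +> a = \<zero>\<^bsub>quotient_left_module R I\<^esub> \<longleftrightarrow> a \<in> I"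
  using coset_eq_iff[of a \<zero>] by (simp add: zero_quotient a_minus_def)

lemma add_quotient:
  "\<lbrakk>a \<in> carrier R; b \<in> carrier R\<rbrakk> \<Longrightarrow>
    (I +> a) \<oplus>\<^bsub>quotient_left_module R I\<^esub> (I +> b) = I +> (a \<oplus> b)"
  by (simp add: quotient_left_module_def I.a_rcos_sum)

lemma smult_quotient:
  assumes "r \<in> carrier R" "a \<in> carrier R"
  shows "r \<odot>\<^bsub>quotient_left_module R I\<^esub> (I +> a) = I +> (r \<otimes> a)"
proof -
  have eq: "I +> (r \<otimes> x) = I +> (r \<otimes> a)" if "x \<in> I +> a" for x
  proof -
    have x: "x \<in> carrier R" using that assms(2) I.a_elemrcos_carrier by blast
    have "x \<ominus> a \<in> I" using I.a_rcos_module_minus[OF ring_axioms assms(2) x] that by simp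
    then have "r \<otimes> (x \<ominus> a) \<in> I" using assms I_mult by simp
    moreover have "r \<otimes> (x \<ominus> a) = r \<otimes> x \<ominus> r \<otimes> a"
      using assms x by (simp add: a_minus_def r_distr r_minus)
    ultimately show ?thesis using assms x by (simp add: coset_eq_iff)
  qed
  have "r \<odot>\<^bsub>quotient_left_module R I\<^esub> (I +> a) = (\<Union>x\<in>I +> a. I +> (r \<otimes> x))"
    by (simp add: quotient_left_module_def)
  also have "\<dots> = (\<Union>x\<in>I +> a. I +> (r \<otimes> a))"
    by (rule SUP_cong[OF refl]) (rule eq)
  also have "\<dots> = I +> (r \<otimes> a)"
    using I.a_rcos_self[OF assms(2)] by blast
  finally show ?thesis .
qed

lemma quotient_is_left_module: "left_module R (quotient_left_module R I)"
proof -
  let ?M = "quotient_left_module R I"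
  have "abelian_group ?M"
  proof (rule abelian_groupI)
    fix x assume "x \<in> carrier ?M"
    then obtain a where "a \<in> carrier R" "x = I +> a" by (auto simp: carrier_quotient)
    then show "\<exists>y\<in>carrier ?M. y \<oplus>\<^bsub>?M\<^esub> x = \<zero>\<^bsub>?M\<^esub>"
      by (intro bexI[of _ "I +> (\<ominus> a)"]) (auto simp: carrier_quotient add_quotient zero_quotient l_neg)
  qed (auto simp: carrier_quotient add_quotient zero_quotient a_ac)
  then show ?thesis
    by (intro left_module.intro left_module_axioms.intro ring_axioms)
      (auto simp: carrier_quotient add_quotient smult_quotient l_distr r_distr m_assoc)
qed

end

text \<open>Right multiplication by \<open>a\<close> maps \<open>R/I\<close> to \<open>R/J\<close> as soon as \<open>I a \<subseteq> J\<close>; every homomorphism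
  between cyclic modules has this form.\<close>

lemma (in ring) quotient_hom_right_mult:
  assumes I: "left_ideal I R" and J: "left_ideal J R" and a: "a \<in> carrier R"
    and Ia: "\<And>x. x \<in> I \<Longrightarrow> x \<otimes> a \<in> J"
  obtains \<phi> where "\<phi> \<in> left_module_hom R (quotient_left_module R I) (quotient_left_module R J)"
    and "\<And>x. x \<in> carrier R \<Longrightarrow> \<phi> (I +> x) = J +> (x \<otimes> a)"
proof -
  interpret I: left_ideal_quotient R I by unfold_locales (rule I)
  interpret J: left_ideal_quotient R J by unfold_locales (rule J)
  define \<phi> where "\<phi> X = J +> ((SOME x. x \<in> carrier R \<and> X = I +> x) \<otimes> a)" for X
  have \<phi>: "\<phi> (I +> x) = J +> (x \<otimes> a)" if x: "x \<in> carrier R" for x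
  proof -
    define y where "y = (SOME y. y \<in> carrier R \<and> I +> x = I +> y)"
    have y: "y \<in> carrier R \<and> I +> x = I +> y"
      unfolding y_def using x by (rule_tac someI[of _ x]) simp
    then have "(y \<ominus> x) \<otimes> a \<in> J" using x I.coset_eq_iff[of y x] Ia by simp
    moreover have "(y \<ominus> x) \<otimes> a = y \<otimes> a \<ominus> x \<otimes> a" using x y a by (simp add: a_minus_def l_distr l_minus)
    ultimately have "J +> (y \<otimes> a) = J +> (x \<otimes> a)" using x y a J.coset_eq_iff by simp
    then show ?thesis by (simp add: \<phi>_def y_def)
  qed
  have "\<phi> \<in> left_module_hom R (quotient_left_module R I) (quotient_left_module R J)"
    unfolding left_module_hom_def
    by (auto simp: I.carrier_quotient J.carrier_quotient I.add_quotient J.add_quotient \<phi> a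
        I.smult_quotient J.smult_quotient l_distr m_assoc)
  then show ?thesis using that \<phi> by blast
qed

text \<open>If the right multiplications by \<open>a\<close> and by \<open>b\<close> map the two ideals into each other and \<open>a b\<close> and
  \<open>b a\<close> are congruent to \<open>1\<close>, the induced maps on the quotients are inverse to each other.\<close>

lemma (in ring) quotient_iso_right_mult:
  assumes I: "left_ideal I R" and J: "left_ideal J R" and a: "a \<in> carrier R" and b: "b \<in> carrier R"
    and Ia: "\<And>x. x \<in> I \<Longrightarrow> x \<otimes> a \<in> J" and Jb: "\<And>x. x \<in> J \<Longrightarrow> x \<otimes> b \<in> I"
    and ab: "a \<otimes> b \<ominus> \<one> \<in> I" and ba: "b \<otimes> a \<ominus> \<one> \<in> J"
  obtains \<phi> where "\<phi> \<in> left_module_iso R (quotient_left_module R I) (quotient_left_module R J)"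
    and "\<And>x. x \<in> carrier R \<Longrightarrow> \<phi> (I +> x) = J +> (x \<otimes> a)"
proof -
  interpret I: left_ideal_quotient R I by unfold_locales (rule I)
  interpret J: left_ideal_quotient R J by unfold_locales (rule J)
  obtain \<phi> where hom: "\<phi> \<in> left_module_hom R (quotient_left_module R I) (quotient_left_module R J)"
    and \<phi>: "\<And>x. x \<in> carrier R \<Longrightarrow> \<phi> (I +> x) = J +> (x \<otimes> a)"
    using quotient_hom_right_mult[OF I J a Ia] by blast
  have cancel: "x \<otimes> (y \<ominus> \<one>) = x \<otimes> y \<ominus> x" if "x \<in> carrier R" "y \<in> carrier R" for x y
    using that by (simp add: a_minus_def r_distr r_minus)
  have "inj_on \<phi> (carrier (quotient_left_module R I))"
  proof (rule inj_onI)
    fix X Y assume "X \<in> carrier (quotient_left_module R I)" "Y \<in> carrier (quotient_left_module R I)" "\<phi> X = \<phi> Y"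
    then obtain x y where xy: "x \<in> carrier R" "y \<in> carrier R" "X = I +> x" "Y = I +> y"
        and eq: "J +> (x \<otimes> a) = J +> (y \<otimes> a)"
      by (auto simp: I.carrier_quotient \<phi>)
    define d where "d = x \<ominus> y"
    have d: "d \<in> carrier R" using xy by (simp add: d_def)
    have "d \<otimes> a = x \<otimes> a \<ominus> y \<otimes> a" using xy a by (simp add: d_def a_minus_def l_distr l_minus)
    also have "\<dots> \<in> J" using eq xy a J.coset_eq_iff by simp
    finally have 1: "(d \<otimes> a) \<otimes> b \<in> I" by (rule Jb)
    have 2: "d \<otimes> (a \<otimes> b \<ominus> \<one>) \<in> I" using d ab by (rule I.I_mult)
    have "d \<otimes> (a \<otimes> b \<ominus> \<one>) = (d \<otimes> a) \<otimes> b \<ominus> d" using d a b by (simp add: cancel m_assoc)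
    then have "d = (d \<otimes> a) \<otimes> b \<ominus> d \<otimes> (a \<otimes> b \<ominus> \<one>)"
      using d a b by (simp add: a_minus_def minus_add r_neg2)
    also have "\<dots> \<in> I" unfolding a_minus_def[where x = "d \<otimes> a \<otimes> b"] by (intro I.I.a_closed I.I.a_inv_closed 1 2)
    finally show "X = Y" using xy by (simp add: I.coset_eq_iff d_def)
  qed
  moreover have "\<phi> ` carrier (quotient_left_module R I) = carrier (quotient_left_module R J)"
  proof
    show "\<phi> ` carrier (quotient_left_module R I) \<subseteq> carrier (quotient_left_module R J)"
      using hom by (auto simp: left_module_hom_def)
    show "carrier (quotient_left_module R J) \<subseteq> \<phi> ` carrier (quotient_left_module R I)"
    proof
      fix Y assume "Y \<in> carrier (quotient_left_module R J)"
      then obtain y where y: "y \<in> carrier R" "Y = J +> y" by (auto simp: J.carrier_quotient)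
      have "y \<otimes> (b \<otimes> a \<ominus> \<one>) \<in> J" using y(1) ba by (rule J.I_mult)
      then have "J +> (y \<otimes> b \<otimes> a) = J +> y" using y(1) a b by (simp add: J.coset_eq_iff cancel m_assoc)
      then have "Y = \<phi> (I +> (y \<otimes> b))" using y b by (simp add: \<phi>)
      then show "Y \<in> \<phi> ` carrier (quotient_left_module R I)" using y b by (auto simp: I.carrier_quotient)
    qed
  qed
  ultimately have "\<phi> \<in> left_module_iso R (quotient_left_module R I) (quotient_left_module R J)"
    using hom by (simp add: left_module_iso_def bij_betw_def)
  then show ?thesis using that \<phi> by blast
qed


section \<open>The left ideal of a vacuum vector is proper\<close>

text \<open>\<open>coeff_along s p f\<close>: in the \<open>m\<close>-th member of the family \<open>p\<close> of polynomials, the coefficient of the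
  monomial with exponents \<open>s v + m\<close> is the value \<open>f(m)\<close>. Small \<open>m\<close> are left out because there the
  exponents can be negative, or multiplication by a variable can produce a coefficient zero that \<open>f\<close>
  does not predict.\<close>

definition coeff_along :: "('v \<Rightarrow> int) \<Rightarrow> (nat \<Rightarrow> 'v cpoly) \<Rightarrow> complex poly \<Rightarrow> bool"
  where "coeff_along s p f \<longleftrightarrow> (\<forall>\<^sub>F m in sequentially. \<forall>a.
    (\<forall>v. int (lookup a v) = s v + int m) \<longrightarrow>
      lookup (p m) a = poly f (of_nat m))"

text \<open>At \<open>m = -1\<close> the exponent of \<open>v\<close> is \<open>s v - 1\<close>. So the condition says that, after continuation to
  \<open>m = -1\<close>, no monomial with negative exponents at all variables in \<open>F\<close> occurs.\<close>

definition vanishing_at_minus_1 :: "'v set \<Rightarrow> (nat \<Rightarrow> 'v cpoly) set"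
  where "vanishing_at_minus_1 F =
    {p. \<forall>s. \<exists>f. coeff_along s p f \<and> ((\<forall>v\<in>F. s v \<le> 0) \<longrightarrow> poly f (-1) = 0)}"

lemma coeff_along_0: "coeff_along s (\<lambda>_. 0) 0"
  by (simp add: coeff_along_def)

lemma coeff_along_add:
  assumes "coeff_along s p f" "coeff_along s q g"
  shows "coeff_along s (\<lambda>m. p m + q m) (f + g)"
  using assms unfolding coeff_along_def by eventually_elim (simp add: lookup_add)

lemma coeff_along_scalar: "coeff_along s p f \<Longrightarrow> coeff_along s (\<lambda>m. scalar_op c (p m)) (smult c f)"
  unfolding coeff_along_def by (erule eventually_mono) (simp add: lookup_scalar_op)

lemma coeff_along_var:
  assumes "coeff_along (s(u := s u - 1)) p f"
  shows "coeff_along s (\<lambda>m. var_op u (p m)) f"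
  using assms eventually_gt_at_top[of "nat (- s u)"] unfolding coeff_along_def
proof eventually_elim
  case (elim m)
  show ?case
  proof (intro allI impI)
    fix a assume a: "\<forall>v. int (lookup a v) = s v + int m"
    have pos: "lookup a u > 0" using elim(2) a[rule_format, of u] by linarith
    then have "\<forall>v. int (lookup (a - unit_exp u) v) = (s(u := s u - 1)) v + int m"
      using a by (auto simp: lookup_minus lookup_single when_def of_nat_diff)
    with elim(1) pos show "lookup (var_op u (p m)) a = poly f (of_nat m)"
      by (simp add: lookup_var_op)
  qed
qed

lemma coeff_along_partial:
  assumes "coeff_along (s(u := s u + 1)) p f"
  shows "coeff_along s (\<lambda>m. partial_op u (p m)) ([:of_int (s u) + 1, 1:] * f)"
  using assms unfolding coeff_along_def
proof (rule eventually_mono)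
  fix m
  assume m: "\<forall>a. (\<forall>v. int (lookup a v) = (s(u := s u + 1)) v + int m) \<longrightarrow>
    lookup (p m) a = poly f (of_nat m)"
  show "\<forall>a. (\<forall>v. int (lookup a v) = s v + int m) \<longrightarrow>
    lookup (partial_op u (p m)) a = poly ([:of_int (s u) + 1, 1:] * f) (of_nat m)"
  proof (intro allI impI)
    fix a assume a: "\<forall>v. int (lookup a v) = s v + int m"
    then have "\<forall>v. int (lookup (unit_exp u + a) v) = (s(u := s u + 1)) v + int m"
      by (auto simp: lookup_add lookup_single when_def)
    with m have 1: "lookup (p m) (unit_exp u + a) = poly f (of_nat m)" by blast
    have "of_int (int (lookup a u)) = (of_int (s u + int m) :: complex)"
      using a by simp
    then have 2: "of_nat (Suc (lookup a u)) = (of_int (s u) + 1 + of_nat m :: complex)"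
      by simp
    show "lookup (partial_op u (p m)) a = poly ([:of_int (s u) + 1, 1:] * f) (of_nat m)"
      unfolding lookup_partial_op 1 2 by (simp add: algebra_simps)
  qed
qed

lemma vanishing_at_minus_1_add:
  assumes "p \<in> vanishing_at_minus_1 F" "q \<in> vanishing_at_minus_1 F"
  shows "(\<lambda>m. p m + q m) \<in> vanishing_at_minus_1 F"
  unfolding vanishing_at_minus_1_def
proof (intro CollectI allI)
  fix s
  from assms obtain f g where "coeff_along s p f" "coeff_along s q g"
      and "(\<forall>v\<in>F. s v \<le> 0) \<longrightarrow> poly f (-1) = 0" "(\<forall>v\<in>F. s v \<le> 0) \<longrightarrow> poly g (-1) = 0"
    unfolding vanishing_at_minus_1_def by blast
  then show "\<exists>f. coeff_along s (\<lambda>m. p m + q m) f \<and> ((\<forall>v\<in>F. s v \<le> 0) \<longrightarrow> poly f (-1) = 0)"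
    by (intro exI[of _ "f + g"]) (simp add: coeff_along_add)
qed

text \<open>Multiplication by a variable raises an exponent, so a monomial that is negative at all of \<open>F\<close> can only
  come from one that is, too. Differentiation lowers an exponent, but in passing from \<open>0\<close> to \<open>-1\<close> it
  brings down the factor \<open>0\<close>.\<close>

lemma vanishing_at_minus_1_weyl:
  assumes "P \<in> carrier weyl_algebra" "p \<in> vanishing_at_minus_1 F"
  shows "(\<lambda>m. P (p m)) \<in> vanishing_at_minus_1 F"
  using assms
proof (induction arbitrary: p rule: weyl_induct)
  case (scalar c)
  show ?case unfolding vanishing_at_minus_1_def
  proof (intro CollectI allI)
    fix s
    from scalar obtain f where "coeff_along s p f" "(\<forall>v\<in>F. s v \<le> 0) \<longrightarrow> poly f (-1) = 0"
      unfolding vanishing_at_minus_1_def by blast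
    then show "\<exists>f. coeff_along s (\<lambda>m. scalar_op c (p m)) f \<and> ((\<forall>v\<in>F. s v \<le> 0) \<longrightarrow> poly f (-1) = 0)"
      by (intro exI[of _ "smult c f"]) (simp add: coeff_along_scalar)
  qed
next
  case (var u)
  show ?case unfolding vanishing_at_minus_1_def
  proof (intro CollectI allI)
    fix s
    from var obtain f where f: "coeff_along (s(u := s u - 1)) p f"
        "(\<forall>v\<in>F. (s(u := s u - 1)) v \<le> 0) \<longrightarrow> poly f (-1) = 0"
      unfolding vanishing_at_minus_1_def by blast
    have "poly f (-1) = 0" if "\<forall>v\<in>F. s v \<le> 0" using f(2) that by fastforce
    with coeff_along_var[OF f(1)]
    show "\<exists>f. coeff_along s (\<lambda>m. var_op u (p m)) f \<and> ((\<forall>v\<in>F. s v \<le> 0) \<longrightarrow> poly f (-1) = 0)"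
      by blast
  qed
next
  case (partial u)
  show ?case unfolding vanishing_at_minus_1_def
  proof (intro CollectI allI)
    fix s
    from partial obtain f where f: "coeff_along (s(u := s u + 1)) p f"
        "(\<forall>v\<in>F. (s(u := s u + 1)) v \<le> 0) \<longrightarrow> poly f (-1) = 0"
      unfolding vanishing_at_minus_1_def by blast
    have "poly ([:of_int (s u) + 1, 1:] * f) (-1) = 0" if "\<forall>v\<in>F. s v \<le> 0"
    proof (cases "s u = 0")
      case False
      with f(2) that have "poly f (-1) = 0" by force
      then show ?thesis by simp
    qed simp
    with coeff_along_partial[OF f(1)]
    show "\<exists>f. coeff_along s (\<lambda>m. partial_op u (p m)) f \<and> ((\<forall>v\<in>F. s v \<le> 0) \<longrightarrow> poly f (-1) = 0)"
      by blast
  qed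
next
  case (add P P')
  show ?case by (intro vanishing_at_minus_1_add add.IH add.prems)
next
  case (comp P P')
  from comp.IH(1)[OF comp.IH(2)[OF comp.prems]] show ?case by (simp only: o_apply)
qed

lemma poly_eq_if_eventually_eq_nat:
  fixes f g :: "'a::field_char_0 poly"
  assumes "\<forall>\<^sub>F m in sequentially. poly f (of_nat m) = poly g (of_nat m)"
  shows "f = g"
proof (rule ccontr)
  assume "f \<noteq> g"
  then have "finite {x. poly (f - g) x = 0}" by (intro poly_roots_finite) simp
  moreover from assms obtain N where "\<forall>m\<ge>N. poly f (of_nat m) = poly g (of_nat m)"
    by (auto simp: eventually_sequentially)
  then have "of_nat ` {N..} \<subseteq> {x. poly (f - g) x = 0}" by auto
  ultimately have "finite (of_nat ` {N..} :: 'a set)" by (rule rev_finite_subset)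
  then have "finite {N..}" by (rule finite_imageD) (simp add: inj_on_def)
  then show False using infinite_Ici[of N] by simp
qed

text \<open>The ideal consists of the operators that take the family \<open>z\<^sup>e\<^sup>(\<^sup>m\<^sup>)\<close>, where \<open>e(m)\<close> is \<open>m\<close> on \<open>F\<close> and
  \<open>m + 1\<close> elsewhere, to a family that vanishes at \<open>-1\<close>. At \<open>m = -1\<close> the exponents are \<open>-1\<close> on \<open>F\<close>
  and \<open>0\<close> elsewhere: a derivative outside \<open>F\<close> gives zero, multiplication by a variable in \<open>F\<close> makes
  the monomial regular in it, but the monomial itself does not vanish.\<close>

lemma ex_proper_left_ideal_vacuum:
  fixes F :: "('v::finite) set"
  obtains I :: "'v pop set" where "left_ideal I weyl_algebra" "\<And>v. v \<notin> F \<Longrightarrow> partial_op v \<in> I"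
    "\<And>v. v \<in> F \<Longrightarrow> var_op v \<in> I" "id \<notin> I"
proof -
  let ?ind = "\<lambda>v. if v \<in> F then 0 else 1 :: int"
  define e where "e m = Abs_poly_mapping (\<lambda>v. if v \<in> F then m else Suc m)" for m
  have e: "lookup (e m) v = (if v \<in> F then m else Suc m)" for m v
    unfolding e_def by (subst lookup_Abs_poly_mapping) auto
  define p where "p m = single (e m) (1::complex)" for m
  have p: "coeff_along s p (if s = ?ind then 1 else 0)" for s
    unfolding coeff_along_def
  proof (intro always_eventually allI impI)
    fix m a assume a: "\<forall>v. int (lookup a v) = s v + int m"
    have "e m = a \<longleftrightarrow> (\<forall>v. int (lookup (e m) v) = int (lookup a v))"
      by (simp add: poly_mapping_eq_iff fun_eq_iff)
    also have "\<dots> \<longleftrightarrow> s = ?ind"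
      unfolding fun_eq_iff using a by (intro all_cong1) (auto simp: e)
    finally show "lookup (p m) a = poly (if s = ?ind then 1 else 0) (of_nat m)"
      by (simp add: p_def lookup_single)
  qed
  define I where "I = {P \<in> carrier weyl_algebra. (\<lambda>m. P (p m)) \<in> vanishing_at_minus_1 F}"
  have "left_ideal I weyl_algebra"
  proof (rule weyl.left_idealI)
    have "(\<lambda>_. 0) \<in> vanishing_at_minus_1 F"
      using coeff_along_0 by (auto simp: vanishing_at_minus_1_def intro!: exI[of _ 0])
    then show "\<zero>\<^bsub>weyl_algebra\<^esub> \<in> I" using weyl_zero by (simp add: I_def weyl_ops)
  next
    fix P Q assume "P \<in> I" "Q \<in> I"
    then show "P \<oplus>\<^bsub>weyl_algebra\<^esub> Q \<in> I"
      using weyl_closed(2) vanishing_at_minus_1_add by (auto simp: I_def weyl_ops)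
  next
    fix P Q :: "'v pop" assume "P \<in> carrier weyl_algebra" "Q \<in> I"
    then show "P \<otimes>\<^bsub>weyl_algebra\<^esub> Q \<in> I"
      using vanishing_at_minus_1_weyl[of P "\<lambda>m. Q (p m)" F] weyl_closed(1)
      by (auto simp: I_def weyl_ops)
  qed (auto simp: I_def)
  moreover have "partial_op u \<in> I" if u: "u \<notin> F" for u
  proof -
    \<comment> \<open>The derivative has a nonzero coefficient only where \<open>s u = 0\<close>, and there the factor \<open>s u + 1 + m\<close>
      vanishes at \<open>m = -1\<close>.\<close>
    have "poly ([:of_int (s u) + 1, 1:] * (if s(u := s u + 1) = ?ind then 1 else 0)) (-1::complex) = 0" for s
      using u by (auto dest: fun_cong[of _ _ u])
    then have "(\<lambda>m. partial_op u (p m)) \<in> vanishing_at_minus_1 F"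
      unfolding vanishing_at_minus_1_def using coeff_along_partial[OF p, of _ u] by blast
    then show ?thesis by (simp add: I_def weyl_mem)
  qed
  moreover have "var_op u \<in> I" if u: "u \<in> F" for u
  proof -
    \<comment> \<open>The product has a nonzero coefficient only where \<open>s u = 1\<close>.\<close>
    have "poly (if s(u := s u - 1) = ?ind then 1 else 0) (-1::complex) = 0" if "\<forall>v\<in>F. s v \<le> 0" for s
      using u that by (auto dest!: fun_cong[of _ _ u])
    then have "(\<lambda>m. var_op u (p m)) \<in> vanishing_at_minus_1 F"
      unfolding vanishing_at_minus_1_def using coeff_along_var[OF p, of _ u] by blast
    then show ?thesis by (simp add: I_def weyl_mem)
  qed
  moreover have "id \<notin> I"
  proof
    assume "id \<in> I"
    then have "p \<in> vanishing_at_minus_1 F" by (simp add: I_def)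
    then have "\<exists>f. coeff_along ?ind p f \<and> ((\<forall>v\<in>F. ?ind v \<le> 0) \<longrightarrow> poly f (-1) = 0)"
      unfolding vanishing_at_minus_1_def by blast
    then obtain f where f: "coeff_along ?ind p f" and f1: "poly f (-1) = 0" by auto
    from f have "\<forall>\<^sub>F m in sequentially. poly f (of_nat m) = poly 1 (of_nat m)"
      unfolding coeff_along_def
    proof eventually_elim
      case (elim m)
      then have "lookup (p m) (e m) = poly f (of_nat m)" by (simp add: e)
      then show ?case by (simp add: p_def)
    qed
    then have "f = 1" by (rule poly_eq_if_eventually_eq_nat)
    with f1 show False by simp
  qed
  ultimately show ?thesis using that by blast
qed


section \<open>Creation and annihilation operators\<close>

definition creation :: "'v set \<Rightarrow> 'v \<Rightarrow> 'v pop"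
  where "creation F v = (if v \<in> F then partial_op v else var_op v)"

definition annihilation :: "'v set \<Rightarrow> 'v \<Rightarrow> 'v pop"
  where "annihilation F v = (if v \<in> F then scalar_op (-1) \<circ> var_op v else partial_op v)"

lemma creation_mem: "creation F v \<in> carrier weyl_algebra"
  by (simp add: creation_def weyl_mem)

lemma annihilation_mem: "annihilation F v \<in> carrier weyl_algebra"
  by (simp add: annihilation_def weyl_mem weyl_closed)

lemma creation_commute: "creation F u (creation F v p) = creation F v (creation F u p)"
  by (cases "u = v") (auto simp: creation_def var_op_commute partial_op_commute partial_op_var_op)

text \<open>The commutation relation of \<open>\<partial>/\<partial>z\<^sub>u\<close> and \<open>z\<^sub>v\<close> is invariant under the Fourier transform
  \<open>z \<mapsto> \<partial>\<close>, \<open>\<partial> \<mapsto> -z\<close>, which is the reason for the sign of annihilation.\<close>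

lemma annihilation_creation:
  "annihilation F u (creation F v p) = creation F v (annihilation F u p) + (if u = v then p else 0)"
  by (auto simp: creation_def annihilation_def var_op_commute partial_op_commute partial_op_var_op
      scalar_op_minus_1 weyl_apply_uminus[OF weyl_mem(2)] weyl_apply_uminus[OF weyl_mem(3)])

lemma funpow_commute_funpow:
  assumes "f \<circ> g = g \<circ> f"
  shows "(f ^^ m) \<circ> (g ^^ n) = (g ^^ n) \<circ> (f ^^ m)"
proof -
  have 1: "f \<circ> (g ^^ n) = (g ^^ n) \<circ> f" for n
  proof (induction n)
    case (Suc n)
    have "f \<circ> (g ^^ Suc n) = (f \<circ> g) \<circ> (g ^^ n)" by (simp add: o_assoc)
    also have "\<dots> = g \<circ> (f \<circ> (g ^^ n))" by (simp only: assms o_assoc)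
    also have "\<dots> = (g ^^ Suc n) \<circ> f" by (simp only: Suc funpow.simps o_assoc)
    finally show ?case .
  qed simp
  show ?thesis
  proof (induction m)
    case (Suc m)
    have "(f ^^ Suc m) \<circ> (g ^^ n) = f \<circ> ((f ^^ m) \<circ> (g ^^ n))" by (simp add: o_assoc)
    also have "\<dots> = (f \<circ> (g ^^ n)) \<circ> (f ^^ m)" by (simp only: Suc o_assoc)
    also have "\<dots> = (g ^^ n) \<circ> (f ^^ Suc m)" by (simp only: 1 funpow.simps o_assoc)
    finally show ?case .
  qed simp
qed

text \<open>The product of the powers of the creation operators with exponents \<open>a\<close>. As these operators
  commute, the fold over the finite type of variables does not depend on an order.\<close>

definition creation_monomial :: "'v set \<Rightarrow> ('v::finite \<Rightarrow>\<^sub>0 nat) \<Rightarrow> 'v pop"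
  where "creation_monomial F a =
    Finite_Set.fold (\<lambda>v G. (creation F v ^^ lookup a v) \<circ> G) id UNIV"

lemma comp_fun_commute_creation: "comp_fun_commute_on UNIV (\<lambda>v G. (creation F v ^^ k v) \<circ> G)"
proof
  fix u v
  have "(creation F u ^^ k u) \<circ> (creation F v ^^ k v) = (creation F v ^^ k v) \<circ> (creation F u ^^ k u)"
    by (rule funpow_commute_funpow) (simp add: fun_eq_iff creation_commute)
  then show "(\<lambda>G. (creation F v ^^ k v) \<circ> G) \<circ> (\<lambda>G. (creation F u ^^ k u) \<circ> G) =
      (\<lambda>G. (creation F u ^^ k u) \<circ> G) \<circ> (\<lambda>G. (creation F v ^^ k v) \<circ> G)"
    by (metis (no_types, lifting) comp_assoc fun_eq_iff o_apply)
qed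

lemma creation_monomial_0 [simp]: "creation_monomial F 0 = id"
proof -
  have "Finite_Set.fold (\<lambda>v G. (creation F v ^^ 0) \<circ> G) id A = id" if "finite A" for A
    using that
  proof (induction A)
    case (insert v A)
    have "Finite_Set.fold (\<lambda>v G. (creation F v ^^ 0) \<circ> G) id (insert v A) =
        (creation F v ^^ 0) \<circ> Finite_Set.fold (\<lambda>v G. (creation F v ^^ 0) \<circ> G) id A"
      by (rule comp_fun_commute_on.fold_insert[OF comp_fun_commute_creation[where k = "\<lambda>_. 0"]])
        (use insert.hyps in auto)
    also have "\<dots> = id" unfolding insert.IH by simp
    finally show ?case .
  qed simp
  from this[of UNIV] show ?thesis by (simp add: creation_monomial_def)
qed

lemma creation_monomial_unit:
  "creation_monomial F (unit_exp v + a) = creation F v \<circ> creation_monomial F a"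
proof -
  have U: "(UNIV :: 'a set) = insert v (- {v})" by auto
  have split: "creation_monomial F b =
      (creation F v ^^ lookup b v) \<circ>
      Finite_Set.fold (\<lambda>u G. (creation F u ^^ lookup b u) \<circ> G) id (- {v})" for b
    unfolding creation_monomial_def
    by (subst U, subst comp_fun_commute_on.fold_insert[OF comp_fun_commute_creation])
      simp_all
  have rest: "Finite_Set.fold (\<lambda>u G. (creation F u ^^ lookup (unit_exp v + a) u) \<circ> G) id (- {v}) =
      Finite_Set.fold (\<lambda>u G. (creation F u ^^ lookup a u) \<circ> G) id (- {v})"
    by (rule Finite_Set.fold_cong[OF comp_fun_commute_creation comp_fun_commute_creation])
      (auto simp: lookup_add lookup_single)
  show ?thesis
    unfolding split rest by (simp add: lookup_add o_assoc flip: Suc_eq_plus1_left)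
qed

lemma creation_monomial_mem: "creation_monomial F a \<in> carrier weyl_algebra"
  by (induction a rule: exponent_induct)
    (simp_all add: creation_monomial_unit weyl_closed creation_mem weyl_id del: id_apply o_apply)

lemma creation_monomial_add:
  "creation_monomial F (a + b) = creation_monomial F a \<circ> creation_monomial F b"
  by (induction a rule: exponent_induct) (simp_all add: creation_monomial_unit add.assoc o_assoc)

text \<open>The operator \<open>p(creation)\<close>.\<close>

definition creation_poly :: "'v set \<Rightarrow> ('v::finite) cpoly \<Rightarrow> 'v pop"
  where "creation_poly F p = (\<lambda>q. \<Sum>a\<in>keys p.
    scalar_op (lookup p a) (creation_monomial F a q))"

lemma creation_poly_add: "creation_poly F (p + p') q = creation_poly F p q + creation_poly F p' q"
  unfolding creation_poly_def
  by (rule sum_keys_add[where g = "\<lambda>a c. scalar_op c (creation_monomial F a q)"])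
    (simp_all add: scalar_op_plus)

lemma creation_poly_single:
  "creation_poly F (single a c) q = scalar_op c (creation_monomial F a q)"
  by (cases "c = 0") (simp_all add: creation_poly_def)

lemma creation_poly_1: "creation_poly F 1 = id"
  using creation_poly_single[of F 0 1] by (simp add: fun_eq_iff)

lemma creation_poly_scalar: "creation_poly F (scalar_op c p) q = scalar_op c (creation_poly F p q)"
  by (induction p rule: poly_mapping_single_add_induct)
    (simp_all add: scalar_op_single creation_poly_single scalar_op_scalar_op scalar_op_add creation_poly_add)

lemma creation_poly_var: "creation_poly F (var_op v p) q = creation F v (creation_poly F p q)"
  by (induction p rule: poly_mapping_single_add_induct)
    (simp_all add: var_op_single creation_poly_single creation_monomial_unit var_op_add
      creation_poly_add weyl_linear[OF creation_mem])

lemma creation_poly_mem: "creation_poly F p \<in> carrier weyl_algebra"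
proof (induction p rule: cpoly_induct)
  case one
  show ?case unfolding creation_poly_1 by (rule weyl_id)
next
  case (scalar c p)
  from weyl_closed(1)[OF weyl_mem(1) this, of c] show ?case
    by (simp add: comp_def creation_poly_scalar[abs_def] eta_contract_eq)
next
  case (var v p)
  from weyl_closed(1)[OF creation_mem this, of F v] show ?case
    by (simp add: comp_def creation_poly_var[abs_def])
next
  case (add p q)
  from weyl_closed(2)[OF add] show ?case by (simp add: creation_poly_add[abs_def])
qed

text \<open>Taking the commutator with an annihilation operator is a derivation that sends the creation operators to
  \<open>0\<close> or \<open>1\<close>; hence it sends \<open>p(creation)\<close> to the value of a partial derivative of \<open>p\<close>.\<close>

lemma annihilation_creation_poly:
  "annihilation F u (creation_poly F p q) =
    creation_poly F p (annihilation F u q) + creation_poly F (partial_op u p) q"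
proof (induction p rule: cpoly_induct)
  case one
  show ?case using creation_poly_single[of F 0 0] by (simp add: creation_poly_1)
next
  case (scalar c p)
  then show ?case
    by (simp add: creation_poly_scalar weyl_linear[OF annihilation_mem] scalar_op_add
        scalar_op_commute_partial[symmetric])
next
  case (var v p)
  have "creation_poly F 0 q = 0" using creation_poly_single[of F 0 0] by simp
  with var show ?case
    by (simp add: creation_poly_var annihilation_creation weyl_linear[OF creation_mem]
        partial_op_var_op creation_poly_add)
next
  case (add p q)
  then show ?case
    by (simp add: creation_poly_add weyl_linear[OF annihilation_mem] partial_op_add)
qed

lemma foldr_comp_Nil: "foldr (\<circ>) [] id = id"
  by simp

lemma foldr_comp_Cons: "foldr (\<circ>) (f # fs) id = f \<circ> foldr (\<circ>) fs id"
  by simp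

lemma foldr_comp_mem:
  "(\<And>f. f \<in> set fs \<Longrightarrow> f \<in> carrier weyl_algebra) \<Longrightarrow> foldr (\<circ>) fs id \<in> carrier weyl_algebra"
proof (induction fs)
  case Nil
  show ?case unfolding foldr_comp_Nil by (rule weyl_id)
next
  case (Cons f fs)
  show ?case unfolding foldr_comp_Cons
    by (intro weyl_closed Cons.IH Cons.prems list.set_intros) assumption
qed

lemma normal_monomial_mem: "normal_monomial vs ws \<in> carrier weyl_algebra"
  unfolding normal_monomial_def by (intro weyl_closed foldr_comp_mem) (auto simp: weyl_mem)

text \<open>A creation monomial involves, for each variable, either \<open>z\<close> or \<open>\<partial>\<close> but never both; all its
  factors commute, so that it can be normally ordered without correction terms.\<close>

lemma creation_monomial_normal:
  "\<exists>vs ws. length vs + length ws = exp_size a \<and> set vs \<inter> F = {} \<and>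
    creation_monomial F a = normal_monomial vs ws"
proof (induction a rule: exponent_induct)
  case zero
  show ?case by (rule exI[of _ "[]"], rule exI[of _ "[]"]) (simp add: normal_monomial_def)
next
  case (unit v a)
  then obtain vs ws where IH: "length vs + length ws = exp_size a" "set vs \<inter> F = {}"
    "creation_monomial F a = normal_monomial vs ws" by blast
  show ?case
  proof (cases "v \<in> F")
    case True
    have "partial_op v \<circ> foldr (\<circ>) (map var_op us) id = foldr (\<circ>) (map var_op us) id \<circ> partial_op v"
      if "v \<notin> set us" for us
      using that
    proof (induction us)
      case (Cons u us)
      then have "partial_op v \<circ> var_op u = var_op u \<circ> partial_op v"
        by (auto simp: fun_eq_iff partial_op_var_op)
      then have "partial_op v \<circ> (var_op u \<circ> G) = var_op u \<circ> (partial_op v \<circ> G)" for G :: "'a pop"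
        by (metis o_assoc)
      note swap = this[of "foldr (\<circ>) (map var_op us) id"]
      from Cons.prems have "v \<notin> set us" by simp
      from Cons.IH[OF this] have "var_op u \<circ> (partial_op v \<circ> foldr (\<circ>) (map var_op us) id) =
          (var_op u \<circ> foldr (\<circ>) (map var_op us) id) \<circ> partial_op v"
        by (metis o_assoc)
      with swap show ?case unfolding list.map foldr_comp_Cons by (simp only:)
    qed (simp only: list.map foldr_comp_Nil o_id id_o)
    note pass = this[of vs]
    have "v \<notin> set vs" using True IH(2) by blast
    from pass[OF this] have "creation F v \<circ> normal_monomial vs ws = normal_monomial vs (v # ws)"
      using True unfolding normal_monomial_def creation_def list.map foldr_comp_Cons
      by (simp only: o_assoc if_True)
    with IH show ?thesis
      by (intro exI[of _ vs] exI[of _ "v # ws"])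
        (simp add: creation_monomial_unit exp_size_add)
  next
    case False
    have "creation F v \<circ> normal_monomial vs ws = normal_monomial (v # vs) ws"
      using False by (simp add: normal_monomial_def creation_def o_assoc)
    with IH False show ?thesis
      by (intro exI[of _ "v # vs"] exI[of _ ws])
        (simp add: creation_monomial_unit exp_size_add)
  qed
qed

lemma bernstein_incl: "length vs + length ws \<le> k \<Longrightarrow> scalar_op c \<circ> normal_monomial vs ws \<in> bernstein k"
  unfolding bernstein_def by (rule generate.incl) blast

lemma creation_monomial_bernstein:
  assumes "exp_size a \<le> k"
  shows "creation_monomial F a \<in> bernstein k"
proof -
  obtain vs ws where "length vs + length ws = exp_size a" "creation_monomial F a = normal_monomial vs ws"
    using creation_monomial_normal by blast
  with assms bernstein_incl[of vs ws k 1] show ?thesis by simp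
qed

lemma bernstein_induct [consumes 1, case_names monomial add]:
  fixes Q :: "'v pop \<Rightarrow> bool"
  assumes "P \<in> bernstein k"
    and mono: "\<And>c vs ws. length vs + length ws \<le> k \<Longrightarrow> Q (scalar_op c \<circ> normal_monomial vs ws)"
    and add: "\<And>P P'. \<lbrakk>P \<in> carrier weyl_algebra; P' \<in> carrier weyl_algebra; Q P; Q P'\<rbrakk> \<Longrightarrow> Q (\<lambda>p. P p + P' p)"
  shows "Q P"
proof -
  have "P \<in> carrier weyl_algebra \<and> Q P"
    using assms(1) unfolding bernstein_def
  proof (induction rule: generate.induct)
    case one
    have "scalar_op 0 \<circ> normal_monomial [] [] = (\<lambda>_. 0 :: 'v cpoly)" by (simp add: fun_eq_iff)
    moreover have "Q (scalar_op 0 \<circ> normal_monomial [] [])" by (rule mono) simp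
    ultimately have "Q (\<lambda>_. 0)" by (simp only:)
    then show ?case using weyl_zero by (simp only: weyl_ops monoid.simps simp_thms)
  next
    case (incl h)
    then show ?case using mono by (auto intro!: weyl_closed weyl_mem normal_monomial_mem)
  next
    case (inv h)
    then obtain c vs ws where h: "h = scalar_op c \<circ> normal_monomial vs ws" "length vs + length ws \<le> k"
      by blast
    have "h \<in> carrier weyl_algebra" unfolding h by (intro weyl_closed weyl_mem normal_monomial_mem)
    then have "inv\<^bsub>add_monoid weyl_algebra\<^esub> h = scalar_op (- c) \<circ> normal_monomial vs ws"
      using weyl_uminus[of h] by (simp add: a_inv_def h fun_eq_iff scalar_op_uminus)
    with mono[OF h(2), of "- c"] show ?case
      using weyl_closed(1)[OF weyl_mem(1) normal_monomial_mem] by metis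
  next
    case (eng P P')
    then show ?case using add[of P P'] weyl_closed(2)[of P P'] by (simp add: weyl_ops)
  qed
  then show ?thesis ..
qed


section \<open>Counting monomials\<close>

text \<open>With a slack entry \<open>k - \<bar>a\<bar>\<close> in front, the exponent vectors of size at most \<open>k\<close> become the lists of
  \<open>n + 1\<close> natural numbers with sum \<open>k\<close>.\<close>

lemma card_exp_size_le:
  "card {a :: 'v::finite \<Rightarrow>\<^sub>0 nat. exp_size a \<le> k} = (k + CARD('v)) choose CARD('v)"
proof -
  let ?n = "CARD('v)"
  obtain vs :: "'v list" where vs: "set vs = UNIV" "distinct vs"
    using finite_distinct_list[of "UNIV :: 'v set"] by auto
  then have len: "length vs = ?n" using distinct_card[of vs] by simp
  have sum: "sum_list (map (lookup a) vs) = exp_size a" for a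
    using sum_list_distinct_conv_sum_set[OF vs(2)] by (simp add: exp_size_def vs(1))
  let ?enc = "\<lambda>a. (k - exp_size a) # map (lookup a) vs"
  have "bij_betw ?enc {a. exp_size a \<le> k} {l. length l = ?n + 1 \<and> sum_list l = k}"
  proof (rule bij_betwI')
    fix a b :: "'v \<Rightarrow>\<^sub>0 nat"
    show "?enc a = ?enc b \<longleftrightarrow> a = b"
      using vs(1) by (auto intro!: poly_mapping_eqI)
  next
    fix a :: "'v \<Rightarrow>\<^sub>0 nat" assume "a \<in> {a. exp_size a \<le> k}"
    then show "?enc a \<in> {l. length l = ?n + 1 \<and> sum_list l = k}" by (simp add: sum len)
  next
    fix l :: "nat list" assume "l \<in> {l. length l = ?n + 1 \<and> sum_list l = k}"
    then obtain d l' where l: "l = d # l'" "length l' = ?n" "d + sum_list l' = k"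
      by (cases l) auto
    define a where "a = Abs_poly_mapping (\<lambda>v. the (map_of (zip vs l') v))"
    have "lookup a = (\<lambda>v. the (map_of (zip vs l') v))"
      unfolding a_def by (subst lookup_Abs_poly_mapping) auto
    then have a: "map (lookup a) vs = l'"
      using l(2) len vs(2) by (intro nth_equalityI) (simp_all add: map_of_zip_nth)
    with sum[of a] l have "a \<in> {a. exp_size a \<le> k}" "?enc a = l" by auto
    then show "\<exists>a\<in>{a. exp_size a \<le> k}. l = ?enc a" by blast
  qed
  then have "card {a :: 'v \<Rightarrow>\<^sub>0 nat. exp_size a \<le> k} = card {l. length l = ?n + 1 \<and> sum_list l = k}"
    by (rule bij_betw_same_card)
  also have "\<dots> = (k + ?n) choose k" by (simp add: card_length_sum_list)
  also have "\<dots> = (k + ?n) choose ?n" by (subst binomial_symmetric) auto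
  finally show ?thesis .
qed

lemma finite_exp_size_le: "finite {a :: 'v::finite \<Rightarrow>\<^sub>0 nat. exp_size a \<le> k}"
  by (rule card_ge_0_finite) (simp add: card_exp_size_le)

lemma binomial_polynomial:
  "\<exists>\<chi> :: real poly. degree \<chi> = n \<and> (\<forall>k. real ((k + n) choose n) = poly \<chi> (real k))"
proof (induction n)
  case 0
  show ?case by (rule exI[of _ 1]) simp
next
  case (Suc n)
  then obtain \<chi> :: "real poly" where \<chi>: "degree \<chi> = n" "\<And>k. real ((k + n) choose n) = poly \<chi> (real k)"
    by blast
  have "poly \<chi> (real 0) \<noteq> 0" using \<chi>(2)[of 0, symmetric] by simp
  then have nz: "\<chi> \<noteq> 0" by auto
  let ?\<chi> = "smult (1 / real (Suc n)) ([:real (Suc n), 1:] * \<chi>)"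
  have "degree ?\<chi> = Suc n"
    using nz \<chi>(1) by (simp add: degree_mult_eq del: of_nat_Suc mult_pCons_left)
  moreover have "real ((k + Suc n) choose Suc n) = poly ?\<chi> (real k)" for k
  proof -
    have "real (Suc n) * real (Suc (k + n) choose Suc n) = real (Suc (k + n)) * poly \<chi> (real k)"
      unfolding \<chi>(2)[symmetric] of_nat_mult[symmetric] Suc_times_binomial ..
    then show ?thesis by (simp add: field_simps del: binomial_Suc_Suc)
  qed
  ultimately show ?case by blast
qed


section \<open>Modules generated by a vacuum vector\<close>

context left_module
begin

lemma smult_r_null: "a \<in> carrier R \<Longrightarrow> a \<odot>\<^bsub>M\<^esub> \<zero>\<^bsub>M\<^esub> = \<zero>\<^bsub>M\<^esub>"
  by (metis M.add.l_cancel_one' M.add.one_closed M.l_zero smult_closed smult_r_distr)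

lemma smult_l_null: "x \<in> carrier M \<Longrightarrow> \<zero> \<odot>\<^bsub>M\<^esub> x = \<zero>\<^bsub>M\<^esub>"
  by (metis M.add.l_cancel_one' R.l_zero R.zero_closed smult_closed smult_l_distr)

lemma smult_l_minus: "\<lbrakk>a \<in> carrier R; x \<in> carrier M\<rbrakk> \<Longrightarrow> (\<ominus> a) \<odot>\<^bsub>M\<^esub> x = \<ominus>\<^bsub>M\<^esub> (a \<odot>\<^bsub>M\<^esub> x)"
  by (metis M.minus_equality R.a_inv_closed R.l_neg smult_closed smult_l_distr smult_l_null)

end

locale weyl_module = left_module weyl_algebra M for M :: "('v::finite pop, 'b, 'm) module_scheme" (structure)
begin

lemma smult_id: "x \<in> carrier M \<Longrightarrow> id \<odot>\<^bsub>M\<^esub> x = x"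
  using smult_one by (simp only: weyl_ops)

lemma smult_comp:
  "\<lbrakk>P \<in> carrier weyl_algebra; Q \<in> carrier weyl_algebra; x \<in> carrier M\<rbrakk> \<Longrightarrow>
    (P \<circ> Q) \<odot>\<^bsub>M\<^esub> x = P \<odot>\<^bsub>M\<^esub> (Q \<odot>\<^bsub>M\<^esub> x)"
  using smult_assoc1[of P Q x] by (simp only: weyl_ops)

lemma smult_plus:
  "\<lbrakk>P \<in> carrier weyl_algebra; Q \<in> carrier weyl_algebra; x \<in> carrier M\<rbrakk> \<Longrightarrow>
    (\<lambda>p. P p + Q p) \<odot>\<^bsub>M\<^esub> x = P \<odot>\<^bsub>M\<^esub> x \<oplus>\<^bsub>M\<^esub> Q \<odot>\<^bsub>M\<^esub> x"
  using smult_l_distr[of P Q x] by (simp only: weyl_ops)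

lemma smult_0: "x \<in> carrier M \<Longrightarrow> (\<lambda>_. 0) \<odot>\<^bsub>M\<^esub> x = \<zero>\<^bsub>M\<^esub>"
  using smult_l_null[of x] by (simp only: weyl_ops)

lemma smult_minus_1: "x \<in> carrier M \<Longrightarrow> scalar_op (-1) \<odot>\<^bsub>M\<^esub> x = \<ominus>\<^bsub>M\<^esub> x"
proof -
  assume x: "x \<in> carrier M"
  have "scalar_op (-1) = \<ominus>\<^bsub>weyl_algebra\<^esub> (id :: 'v pop)"
    unfolding weyl_uminus[OF weyl_id] by (simp add: scalar_op_minus_1 fun_eq_iff)
  with smult_l_minus[OF weyl_id x] show ?thesis using smult_id[OF x] by metis
qed

text \<open>Used to see that the states of a vacuum vector form a submodule.\<close>

lemma stable_under_weyl:
  assumes "P \<in> carrier weyl_algebra" "x \<in> U" "U \<subseteq> carrier M"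
    and scalar: "\<And>c x. x \<in> U \<Longrightarrow> scalar_op c \<odot>\<^bsub>M\<^esub> x \<in> U"
    and var: "\<And>v x. x \<in> U \<Longrightarrow> var_op v \<odot>\<^bsub>M\<^esub> x \<in> U"
    and partial: "\<And>v x. x \<in> U \<Longrightarrow> partial_op v \<odot>\<^bsub>M\<^esub> x \<in> U"
    and add: "\<And>x y. \<lbrakk>x \<in> U; y \<in> U\<rbrakk> \<Longrightarrow> x \<oplus>\<^bsub>M\<^esub> y \<in> U"
  shows "P \<odot>\<^bsub>M\<^esub> x \<in> U"
  using assms(1,2)
proof (induction arbitrary: x rule: weyl_induct)
  case (add P P')
  then have "x \<in> carrier M" using assms(3) by blast
  with add assms(6,7) show ?case by (simp add: smult_plus)
next
  case (comp P P')
  then have "x \<in> carrier M" using assms(3) by blast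
  from comp.IH(1)[OF comp.IH(2)[OF comp.prems]] show ?case
    unfolding smult_comp[OF comp.hyps \<open>x \<in> carrier M\<close>] .
qed (use scalar var partial in auto)

lemma annihilator_left_ideal:
  assumes "x \<in> carrier M"
  shows "left_ideal {P \<in> carrier weyl_algebra. P \<odot>\<^bsub>M\<^esub> x = \<zero>\<^bsub>M\<^esub>} weyl_algebra"
  by (rule weyl.left_idealI)
    (use assms in \<open>auto simp: smult_l_null smult_l_distr smult_assoc1 smult_r_null\<close>)

end

text \<open>A vector killed by the annihilation operators gives the intertwining map from polynomials, by which
  computations in the module become computations with polynomials.\<close>

locale vacuum_vector = weyl_module M for M :: "('v::finite pop, 'b, 'm) module_scheme" (structure) +
  fixes F :: "'v set" and e :: 'b
  assumes vacuum_mem: "e \<in> carrier M"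
    and annihilated: "\<And>v. annihilation F v \<odot>\<^bsub>M\<^esub> e = \<zero>\<^bsub>M\<^esub>"
begin

definition state :: "'v cpoly \<Rightarrow> 'b"
  where "state p = creation_poly F p \<odot>\<^bsub>M\<^esub> e"

lemma state_mem: "state p \<in> carrier M"
  by (simp add: state_def smult_closed creation_poly_mem vacuum_mem)

lemma state_add: "state (p + q) = state p \<oplus>\<^bsub>M\<^esub> state q"
  unfolding state_def smult_plus[OF creation_poly_mem creation_poly_mem vacuum_mem, symmetric]
  by (rule arg_cong[where f = "\<lambda>P. P \<odot>\<^bsub>M\<^esub> e"]) (simp add: fun_eq_iff creation_poly_add)

lemma state_scalar: "state (scalar_op c p) = scalar_op c \<odot>\<^bsub>M\<^esub> state p"
  unfolding state_def smult_comp[OF weyl_mem(1) creation_poly_mem vacuum_mem, symmetric]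
  by (rule arg_cong[where f = "\<lambda>P. P \<odot>\<^bsub>M\<^esub> e"]) (simp add: fun_eq_iff creation_poly_scalar)

lemma state_var: "state (var_op v p) = creation F v \<odot>\<^bsub>M\<^esub> state p"
  unfolding state_def smult_comp[OF creation_mem creation_poly_mem vacuum_mem, symmetric]
  by (rule arg_cong[where f = "\<lambda>P. P \<odot>\<^bsub>M\<^esub> e"]) (simp add: fun_eq_iff creation_poly_var)

text \<open>Moving the annihilation operator to the right of \<open>p(creation)\<close> leaves the derivative of \<open>p\<close>, and then it
  kills the vacuum.\<close>

lemma state_partial: "state (partial_op v p) = annihilation F v \<odot>\<^bsub>M\<^esub> state p"
proof -
  have "annihilation F v \<odot>\<^bsub>M\<^esub> state p = (annihilation F v \<circ> creation_poly F p) \<odot>\<^bsub>M\<^esub> e"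
    unfolding state_def by (rule smult_comp[OF annihilation_mem creation_poly_mem vacuum_mem, symmetric])
  also have "annihilation F v \<circ> creation_poly F p =
      (\<lambda>q. (creation_poly F p \<circ> annihilation F v) q + creation_poly F (partial_op v p) q)"
    by (simp add: fun_eq_iff annihilation_creation_poly)
  also have "\<dots> \<odot>\<^bsub>M\<^esub> e = creation_poly F p \<odot>\<^bsub>M\<^esub> (annihilation F v \<odot>\<^bsub>M\<^esub> e) \<oplus>\<^bsub>M\<^esub> state (partial_op v p)"
    by (subst smult_plus)
      (simp_all add: weyl_closed creation_poly_mem annihilation_mem vacuum_mem smult_comp state_def del: o_apply)
  also have "\<dots> = state (partial_op v p)"
    by (simp add: annihilated smult_r_null creation_poly_mem state_mem)
  finally show ?thesis ..
qed

lemma state_0: "state 0 = \<zero>\<^bsub>M\<^esub>"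
  using state_scalar[of 0 0] by (simp add: smult_0 state_mem)

lemma state_1: "state 1 = e"
  by (simp only: state_def creation_poly_1 smult_id[OF vacuum_mem])

lemma state_uminus: "state (- p) = \<ominus>\<^bsub>M\<^esub> state p"
  using state_scalar[of "-1" p] by (simp add: scalar_op_minus_1[symmetric] smult_minus_1 state_mem) 

lemma var_op_state:
  "var_op v \<odot>\<^bsub>M\<^esub> state p = state (if v \<in> F then - partial_op v p else var_op v p)"
proof (cases "v \<in> F")
  case True
  have "var_op v = scalar_op (-1) \<circ> annihilation F v"
    using True by (simp add: annihilation_def fun_eq_iff scalar_op_minus_1)
  then have "var_op v \<odot>\<^bsub>M\<^esub> state p = scalar_op (-1) \<odot>\<^bsub>M\<^esub> state (partial_op v p)"
    by (simp only: smult_comp[OF weyl_mem(1) annihilation_mem state_mem] state_partial)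
  with True show ?thesis by (simp add: state_uminus smult_minus_1 state_mem)
qed (simp add: state_var creation_def)

lemma partial_op_state:
  "partial_op v \<odot>\<^bsub>M\<^esub> state p = state (if v \<in> F then var_op v p else partial_op v p)"
  by (simp add: state_var state_partial creation_def annihilation_def)

lemma weyl_state:
  assumes "P \<in> carrier weyl_algebra"
  shows "P \<odot>\<^bsub>M\<^esub> state p \<in> range state"
  by (rule stable_under_weyl[OF assms])
    (auto simp: state_mem var_op_state partial_op_state state_scalar[symmetric] state_add[symmetric])

lemma state_sum:
  "finite A \<Longrightarrow> state (\<Sum>a\<in>A. f a) = (\<Oplus>\<^bsub>M\<^esub>a\<in>A. state (f a))"
  by (induction A rule: finite_induct) (simp_all add: state_0 state_add state_mem M.finsum_insert Pi_def)

end

locale cyclic_vacuum = vacuum_vector M F e for M :: "('v::finite pop, 'b, 'm) module_scheme" (structure) and F e +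
  assumes vacuum_nonzero: "e \<noteq> \<zero>\<^bsub>M\<^esub>"
    and generated: "\<And>x. x \<in> carrier M \<Longrightarrow> \<exists>P\<in>carrier weyl_algebra. x = P \<odot>\<^bsub>M\<^esub> e"
begin

lemma range_state: "range state = carrier M"
proof
  show "carrier M \<subseteq> range state"
    using generated weyl_state[of _ 1] by (auto simp: state_1)
qed (auto simp: state_mem)

text \<open>The kernel is stable under \<open>\<partial>\<close>; if it were not zero it would contain \<open>1\<close>, and \<open>e\<close> would vanish.\<close>

lemma state_eq_0: "state p = \<zero>\<^bsub>M\<^esub> \<longleftrightarrow> p = 0"
proof
  assume p: "state p = \<zero>\<^bsub>M\<^esub>"
  show "p = 0"
  proof (rule ccontr)
    assume "p \<noteq> 0"
    with p have "1 \<in> {p. state p = \<zero>\<^bsub>M\<^esub>}"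
      by (intro differentiation_closed_contains_1)
        (auto simp: state_scalar state_partial smult_r_null weyl_mem annihilation_mem)
    with vacuum_nonzero show False by (simp add: state_1)
  qed
qed (simp add: state_0)

lemma inj_state: "inj state"
proof (rule injI)
  fix p q assume pq: "state p = state q"
  have "state (p + - q) = \<zero>\<^bsub>M\<^esub>"
    unfolding state_add state_uminus pq by (simp add: M.r_neg state_mem)
  then show "p = q" unfolding state_eq_0 by simp
qed

text \<open>The preimage of a submodule under the map from polynomials is stable under \<open>\<partial>\<close>, so it is zero or it
  contains \<open>1\<close>; in the second case the submodule contains the generator \<open>e\<close>.\<close>

lemma simple: "simple_left_module weyl_algebra M"
  unfolding simple_left_module_def
proof (intro conjI allI impI)
  show "left_module weyl_algebra M" by (rule left_module_axioms)
  show "carrier M \<noteq> {\<zero>\<^bsub>M\<^esub>}" using vacuum_nonzero vacuum_mem by blast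
  fix N assume "submodule N weyl_algebra M"
  then interpret N: submodule N weyl_algebra M .
  show "N = {\<zero>\<^bsub>M\<^esub>} \<or> N = carrier M"
  proof (cases "\<exists>p. p \<noteq> 0 \<and> state p \<in> N")
    case True
    then obtain p where "p \<noteq> 0" "state p \<in> N" by blast
    then have "1 \<in> {p. state p \<in> N}"
      by (intro differentiation_closed_contains_1)
        (auto simp: state_scalar state_partial weyl_mem annihilation_mem)
    then have "e \<in> N" by (simp add: state_1)
    then have "carrier M \<subseteq> N" using generated N.smult_closed by blast
    with N.subset show ?thesis by auto
  next
    case False
    have N0: "x = \<zero>\<^bsub>M\<^esub>" if x: "x \<in> N" for x
    proof -
      from x N.subset have "x \<in> carrier M" by auto
      then obtain p where "x = state p" unfolding range_state[symmetric] by blast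
      with x False show ?thesis by (metis state_0)
    qed
    have "\<zero>\<^bsub>M\<^esub> \<in> N" using N.one_closed by simp
    then have "N = {\<zero>\<^bsub>M\<^esub>}" by (intro equalityI subsetI singletonI) (simp_all add: N0)
    then show ?thesis ..
  qed
qed

definition filtration :: "nat \<Rightarrow> 'b set"
  where "filtration k = state ` polys_upto k"

lemma filtration_iff: "state p \<in> filtration k \<longleftrightarrow> p \<in> polys_upto k"
  unfolding filtration_def by (rule inj_image_mem_iff[OF inj_state])

lemma filtration_carrier: "filtration k \<subseteq> carrier M"
  by (auto simp: filtration_def state_mem)

lemma filtration_mono: "k \<le> k' \<Longrightarrow> filtration k \<subseteq> filtration k'"
  unfolding filtration_def by (rule image_mono) (auto simp: polys_upto_def)

lemma filtration_0: "\<zero>\<^bsub>M\<^esub> \<in> filtration k"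
  unfolding state_0[symmetric] filtration_iff by (simp add: polys_upto_iff)

lemma filtration_add: "\<lbrakk>x \<in> filtration k; y \<in> filtration k\<rbrakk> \<Longrightarrow> x \<oplus>\<^bsub>M\<^esub> y \<in> filtration k"
  by (auto simp: filtration_def state_add[symmetric] image_iff polys_upto_iff lookup_add intro!: bexI[of _ "_ + _"])

lemma filtration_scalar: "x \<in> filtration k \<Longrightarrow> scalar_op c \<odot>\<^bsub>M\<^esub> x \<in> filtration k"
  unfolding filtration_def
  by (auto simp: state_scalar[symmetric] polys_upto_iff lookup_scalar_op intro!: imageI)

lemma filtration_generator:
  assumes "x \<in> filtration k"
  shows "var_op v \<odot>\<^bsub>M\<^esub> x \<in> filtration (Suc k)" "partial_op v \<odot>\<^bsub>M\<^esub> x \<in> filtration (Suc k)"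
proof -
  obtain p where p: "x = state p" "p \<in> polys_upto k" using assms by (auto simp: filtration_def)
  have var: "var_op v p \<in> polys_upto (Suc k)"
    unfolding polys_upto_iff
  proof (intro allI impI)
    fix a :: "'v \<Rightarrow>\<^sub>0 nat" assume a: "Suc k < exp_size a"
    have "k < exp_size (a - unit_exp v)" if "lookup a v > 0"
      using a arg_cong[OF unit_exp_diff_add[OF that], of exp_size] by (simp add: exp_size_add)
    with p(2) show "lookup (var_op v p) a = 0"
      by (auto simp: lookup_var_op polys_upto_iff)
  qed
  have partial: "partial_op v p \<in> polys_upto (Suc k)"
    using p(2) by (auto simp: lookup_partial_op polys_upto_iff exp_size_add)
  then have "- partial_op v p \<in> polys_upto (Suc k)" by (simp add: polys_upto_iff)
  with var partial show "var_op v \<odot>\<^bsub>M\<^esub> x \<in> filtration (Suc k)" "partial_op v \<odot>\<^bsub>M\<^esub> x \<in> filtration (Suc k)"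
    unfolding p(1) var_op_state partial_op_state filtration_iff by auto
qed

lemma filtration_normal_monomial:
  assumes "x \<in> filtration k"
  shows "normal_monomial vs ws \<odot>\<^bsub>M\<^esub> x \<in> filtration (length vs + length ws + k)"
proof -
  have step: "foldr (\<circ>) (map g us) id \<odot>\<^bsub>M\<^esub> x \<in> filtration (length us + k)"
    if "x \<in> filtration k" and g: "\<And>v. g v \<in> carrier weyl_algebra"
      and "\<And>v x k. x \<in> filtration k \<Longrightarrow> g v \<odot>\<^bsub>M\<^esub> x \<in> filtration (Suc k)"
    for g :: "'v \<Rightarrow> 'v pop" and us x k
  proof (induction us)
    case Nil
    show ?case unfolding list.map foldr_comp_Nil using that(1) filtration_carrier
      by (subst smult_id) auto
  next
    case (Cons u us)
    have mem: "foldr (\<circ>) (map g us) id \<in> carrier weyl_algebra"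
      by (rule foldr_comp_mem) (use g in auto)
    have x: "x \<in> carrier M" using that(1) filtration_carrier by blast
    show ?case
      unfolding list.map foldr_comp_Cons smult_comp[OF g mem x] length_Cons add_Suc
      by (rule that(3)[OF Cons])
  qed
  have x: "x \<in> carrier M" using assms filtration_carrier by blast
  have "foldr (\<circ>) (map partial_op ws) id \<odot>\<^bsub>M\<^esub> x \<in> filtration (length ws + k)"
    by (rule step[OF assms weyl_mem(3) filtration_generator(2)])
  then have "foldr (\<circ>) (map var_op vs) id \<odot>\<^bsub>M\<^esub> (foldr (\<circ>) (map partial_op ws) id \<odot>\<^bsub>M\<^esub> x)
      \<in> filtration (length vs + (length ws + k))"
    by (rule step[OF _ weyl_mem(2) filtration_generator(1)])
  moreover have "foldr (\<circ>) (map var_op vs) id \<in> carrier weyl_algebra"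
      "foldr (\<circ>) (map partial_op ws) id \<in> carrier weyl_algebra"
    by (rule foldr_comp_mem, auto simp: weyl_mem)+
  ultimately show ?thesis
    unfolding normal_monomial_def by (simp only: smult_comp x add.assoc)
qed

lemma filtration_bernstein:
  assumes "P \<in> bernstein i" "x \<in> filtration k"
  shows "P \<odot>\<^bsub>M\<^esub> x \<in> filtration (i + k)"
  using assms(1)
proof (induction rule: bernstein_induct)
  case (monomial c vs ws)
  have x: "x \<in> carrier M" using assms filtration_carrier by blast
  have "normal_monomial vs ws \<odot>\<^bsub>M\<^esub> x \<in> filtration (i + k)"
    using filtration_normal_monomial[OF assms(2), of vs ws]
      filtration_mono[of "length vs + length ws + k" "i + k"] monomial by auto
  from filtration_scalar[OF this, of c] show ?case
    by (subst smult_comp[OF weyl_mem(1) normal_monomial_mem x])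
next
  case (add P P')
  have x: "x \<in> carrier M" using assms filtration_carrier by blast
  from filtration_add[OF add.IH] show ?case
    by (subst smult_plus[OF add.hyps x])
qed

text \<open>Equality holds in all degrees: a monomial of degree at most \<open>i + k\<close> is a product of monomials of
  degrees at most \<open>i\<close> and \<open>k\<close>, and the first factor lifts to a creation monomial in the \<open>i\<close>-th step of
  the Bernstein filtration.\<close>

lemma bernstein_prod_filtration: "bernstein_prod M i (filtration k) = filtration (i + k)"
proof
  show "bernstein_prod M i (filtration k) \<subseteq> filtration (i + k)"
  proof
    fix y assume "y \<in> bernstein_prod M i (filtration k)"
    then show "y \<in> filtration (i + k)" unfolding bernstein_prod_def
    proof (induction rule: generate.induct)
      case one
      then show ?case using filtration_0 by simp
    next
      case (incl h)
      then show ?case using filtration_bernstein by blast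
    next
      case (inv h)
      then have h: "h \<in> filtration (i + k)" using filtration_bernstein by blast
      then have "h \<in> carrier M" using filtration_carrier by blast
      from smult_minus_1[OF this] have "inv\<^bsub>add_monoid M\<^esub> h = scalar_op (-1) \<odot>\<^bsub>M\<^esub> h"
        by (simp add: a_inv_def)
      with filtration_scalar[OF h] show ?case by simp
    next
      case (eng h h')
      then show ?case using filtration_add by simp
    qed
  qed
next
  have split: "\<exists>b c. a = b + c \<and> exp_size b \<le> i \<and> exp_size c \<le> k" if "exp_size a \<le> i + k"
    for a :: "'v \<Rightarrow>\<^sub>0 nat"
    using that
  proof (induction a rule: exponent_induct)
    case zero
    show ?case by (rule exI[of _ 0], rule exI[of _ 0]) simp
  next
    case (unit v a)
    then obtain b c where bc: "a = b + c" "exp_size b \<le> i" "exp_size c \<le> k"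
      by (auto simp: exp_size_add)
    show ?case
    proof (cases "exp_size b < i")
      case True
      with bc show ?thesis
        by (intro exI[of _ "unit_exp v + b"] exI[of _ c]) (simp add: exp_size_add add.assoc)
    next
      case False
      with bc unit.prems show ?thesis
        by (intro exI[of _ b] exI[of _ "unit_exp v + c"]) (simp add: exp_size_add add.left_commute)
    qed
  qed
  show "filtration (i + k) \<subseteq> bernstein_prod M i (filtration k)"
  proof
    fix y assume "y \<in> filtration (i + k)"
    then obtain p where p: "y = state p" "p \<in> polys_upto (i + k)" by (auto simp: filtration_def)
    have mono: "state (single a c) \<in> bernstein_prod M i (filtration k)"
      if "exp_size a \<le> i + k" for a c
    proof -
      obtain b b' where b: "a = b + b'" "exp_size b \<le> i" "exp_size b' \<le> k" using split \<open>exp_size a \<le> i + k\<close> by blast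
      have "creation_poly F (single a c) =
          creation_monomial F b \<circ> creation_poly F (single b' c)"
        by (simp add: fun_eq_iff creation_poly_single b(1) creation_monomial_add
            weyl_linear(2)[OF creation_monomial_mem])
      then have "state (single a c) =
          creation_monomial F b \<odot>\<^bsub>M\<^esub> state (single b' c)"
        unfolding state_def by (simp only: smult_comp[OF creation_monomial_mem creation_poly_mem vacuum_mem])
      moreover have "state (single b' c) \<in> filtration k"
        unfolding filtration_iff using b(3) by (auto simp: polys_upto_def)
      ultimately show ?thesis
        unfolding bernstein_prod_def using creation_monomial_bernstein[OF b(2), of F]
        by (intro generate.incl) blast
    qed
    have "state (\<Sum>a\<in>A. single a (lookup p a)) \<in> bernstein_prod M i (filtration k)"
      if "finite A" "\<forall>a\<in>A. exp_size a \<le> i + k" for A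
      using that
    proof induction
      case empty
      show ?case using mono[of 0 0] by simp
    next
      case (insert a A)
      then have "state (single a (lookup p a)) \<in> bernstein_prod M i (filtration k)"
        "state (\<Sum>a\<in>A. single a (lookup p a)) \<in> bernstein_prod M i (filtration k)"
        using mono by auto
      from generate.eng[OF this[unfolded bernstein_prod_def]] show ?case
        using insert.hyps by (simp add: state_add bernstein_prod_def)
    qed
    from this[of "keys p"] show "y \<in> bernstein_prod M i (filtration k)"
      using p by (simp add: sum_single_keys polys_upto_def)
  qed
qed

text \<open>The images of the monomials of degree at most \<open>k\<close> are a basis. A coordinate vector is indexed by
  these images rather than by the monomials, hence the detour over the inverse of the injection.\<close>

lemma dim_filtration: "complex_dim M (filtration k) ((k + CARD('v)) choose CARD('v))"
proof -
  let ?E = "{a :: 'v \<Rightarrow>\<^sub>0 nat. exp_size a \<le> k}"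
  let ?m = "\<lambda>a. state (single a 1)"
  have inj: "inj_on ?m A" for A
    by (rule inj_onI) (metis inj_single inj_state injD keys_single singleton_inject zero_neq_one)
  have fin: "finite ?E" by (rule finite_exp_size_le)
  have comb: "(\<Oplus>\<^bsub>M\<^esub>b\<in>?m ` ?E. scalar_op (c b) \<odot>\<^bsub>M\<^esub> b) =
      state (\<Sum>a\<in>?E. single a (c (?m a)))" for c
  proof -
    have "(\<Oplus>\<^bsub>M\<^esub>b\<in>?m ` ?E. scalar_op (c b) \<odot>\<^bsub>M\<^esub> b) = (\<Oplus>\<^bsub>M\<^esub>a\<in>?E. scalar_op (c (?m a)) \<odot>\<^bsub>M\<^esub> ?m a)"
      by (rule M.finsum_reindex) (auto simp: smult_closed weyl_mem state_mem inj)
    also have "\<dots> = (\<Oplus>\<^bsub>M\<^esub>a\<in>?E. state (single a (c (?m a))))"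
      by (simp add: state_scalar[symmetric] scalar_op_single)
    also have "\<dots> = state (\<Sum>a\<in>?E. single a (c (?m a)))"
      by (rule state_sum[OF fin, symmetric])
    finally show ?thesis .
  qed
  have lookup: "lookup (\<Sum>a\<in>?E. single a (f a)) b = (if b \<in> ?E then f b else 0)"
    for f :: "('v \<Rightarrow>\<^sub>0 nat) \<Rightarrow> complex" and b
    by (simp add: lookup_sum lookup_single when_def fin)
  have "bij_betw (\<lambda>c. \<Oplus>\<^bsub>M\<^esub>b\<in>?m ` ?E. scalar_op (c b) \<odot>\<^bsub>M\<^esub> b) (?m ` ?E \<rightarrow>\<^sub>E UNIV) (filtration k)"
    unfolding comb
  proof (rule bij_betwI')
    fix c d assume c: "c \<in> ?m ` ?E \<rightarrow>\<^sub>E (UNIV :: complex set)" and d: "d \<in> ?m ` ?E \<rightarrow>\<^sub>E (UNIV :: complex set)"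
    show "state (\<Sum>a\<in>?E. single a (c (?m a))) = state (\<Sum>a\<in>?E. single a (d (?m a))) \<longleftrightarrow> c = d"
    proof
      assume "state (\<Sum>a\<in>?E. single a (c (?m a))) = state (\<Sum>a\<in>?E. single a (d (?m a)))"
      then have eq: "(\<Sum>a\<in>?E. single a (c (?m a))) = (\<Sum>a\<in>?E. single a (d (?m a)))"
        by (rule injD[OF inj_state])
      have "c (?m b) = d (?m b)" if "b \<in> ?E" for b
        using arg_cong[OF eq, of "\<lambda>p. lookup p b"] that
        unfolding lookup by simp
      then show "c = d" by (intro PiE_ext[OF c d]) blast
    qed simp
  next
    fix c assume "c \<in> ?m ` ?E \<rightarrow>\<^sub>E (UNIV :: complex set)"
    show "state (\<Sum>a\<in>?E. single a (c (?m a))) \<in> filtration k"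
      unfolding filtration_iff polys_upto_iff lookup by auto
  next
    fix x assume "x \<in> filtration k"
    then obtain p where p: "x = state p" "p \<in> polys_upto k" by (auto simp: filtration_def)
    let ?c = "\<lambda>b\<in>?m ` ?E. lookup p (inv_into ?E ?m b)"
    have "(\<Sum>a\<in>?E. single a (?c (?m a))) = p"
    proof (rule poly_mapping_eqI)
      fix b
      show "lookup (\<Sum>a\<in>?E. single a (?c (?m a))) b = lookup p b"
      proof (cases "b \<in> ?E")
        case True
        then have "?c (?m b) = lookup p b"
          by (simp add: inv_into_f_f[OF inj True])
        with True show ?thesis unfolding lookup by simp
      next
        case False
        with p(2) show ?thesis unfolding lookup by (simp add: polys_upto_iff)
      qed
    qed
    with p(1) have "x = state (\<Sum>a\<in>?E. single a (?c (?m a)))" by simp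
    moreover have "?c \<in> ?m ` ?E \<rightarrow>\<^sub>E UNIV" by simp
    ultimately show "\<exists>c\<in>?m ` ?E \<rightarrow>\<^sub>E UNIV. x = state (\<Sum>a\<in>?E. single a (c (?m a)))" by blast
  qed
  moreover have "card (?m ` ?E) = (k + CARD('v)) choose CARD('v)"
    by (simp add: card_image[OF inj] card_exp_size_le)
  ultimately show ?thesis
    unfolding complex_dim_def using fin by (intro exI[of _ "?m ` ?E"]) (auto simp: state_mem)
qed

lemma simple_holonomic: "simple_holonomic M"
proof -
  have "p \<in> polys_upto (\<Sum>a\<in>keys p. exp_size a)" for p :: "'v cpoly"
    unfolding polys_upto_def using member_le_sum[of _ "keys p" exp_size] by auto
  then have "(\<Union>k. filtration k) = carrier M"
    unfolding range_state[symmetric] filtration_def by blast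
  then have "good_filtration M filtration"
    unfolding good_filtration_def bernstein_prod_filtration
    using dim_filtration filtration_mono by (intro conjI) (blast, simp, blast, blast, blast)
  moreover obtain \<chi> :: "real poly" where \<chi>: "degree \<chi> = CARD('v)"
      "\<And>k. real ((k + CARD('v)) choose CARD('v)) = poly \<chi> (real k)"
    using binomial_polynomial by blast
  then have "\<forall>\<^sub>F k in sequentially. \<exists>d. complex_dim M (filtration k) d \<and> real d = poly \<chi> (real k)"
    using dim_filtration by (intro always_eventually) blast
  ultimately show ?thesis
    unfolding simple_holonomic_def holonomic_def using simple left_module_axioms \<chi>(1) by blast
qed

end


section \<open>Left ideals of the Weyl algebra\<close>

locale weyl_left_ideal = left_ideal_quotient weyl_algebra I for I :: "('v::finite) pop set"
begin

lemma ideal_weyl: "P \<in> I \<Longrightarrow> P \<in> carrier weyl_algebra"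
  by (rule I.a_Hcarr)

lemma ideal_plus: "\<lbrakk>P \<in> I; Q \<in> I\<rbrakk> \<Longrightarrow> (\<lambda>p. P p + Q p) \<in> I"
  using I.a_closed[of P Q] by (simp only: weyl_ops)

lemma ideal_comp: "\<lbrakk>P \<in> carrier weyl_algebra; Q \<in> I\<rbrakk> \<Longrightarrow> P \<circ> Q \<in> I"
  using I_mult[of P Q] by (simp only: weyl_ops)

lemma ideal_scalar: "P \<in> I \<Longrightarrow> P \<circ> scalar_op c \<in> I"
proof -
  assume P: "P \<in> I"
  then have "P \<circ> scalar_op c = scalar_op c \<circ> P"
    by (simp add: fun_eq_iff weyl_linear(2)[OF ideal_weyl])
  with ideal_comp[OF weyl_mem(1) P] show ?thesis by metis
qed

lemma coset_eq:
  "\<lbrakk>P \<in> carrier weyl_algebra; Q \<in> carrier weyl_algebra\<rbrakk> \<Longrightarrow>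
    I +>\<^bsub>weyl_algebra\<^esub> P = I +>\<^bsub>weyl_algebra\<^esub> Q \<longleftrightarrow> (\<lambda>p. P p - Q p) \<in> I"
  using coset_eq_iff[of P Q] by (simp only: weyl_minus)

sublocale quotient: weyl_module "quotient_left_module weyl_algebra I"
  unfolding weyl_module_def by (rule quotient_is_left_module)

lemma smult_coset:
  "\<lbrakk>P \<in> carrier weyl_algebra; Q \<in> carrier weyl_algebra\<rbrakk> \<Longrightarrow>
    P \<odot>\<^bsub>quotient_left_module weyl_algebra I\<^esub> (I +>\<^bsub>weyl_algebra\<^esub> Q) = I +>\<^bsub>weyl_algebra\<^esub> (P \<circ> Q)"
  using smult_quotient[of P Q] by (simp only: weyl_ops)

lemma coset_mem: "P \<in> carrier weyl_algebra \<Longrightarrow> I +>\<^bsub>weyl_algebra\<^esub> P \<in> carrier (quotient_left_module weyl_algebra I)"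
  by (simp add: carrier_quotient)

end

lemma weyl_left_idealI: "left_ideal I weyl_algebra \<Longrightarrow> weyl_left_ideal I"
  by (simp add: weyl_left_ideal_def left_ideal_quotient_def left_ideal_quotient_axioms_def weyl_ring)


section \<open>Powers of variables and derivatives\<close>

lemma var_op_funpow_single:
  "(var_op v ^^ k) (single a c) = single (single v k + a) c"
proof (induction k)
  case (Suc k)
  have "unit_exp v + (single v k + a) = single v (Suc k) + a"
    using single_add[of v 1 k] by (simp only: plus_1_eq_Suc add.assoc)
  with Suc show ?case by (simp add: var_op_single)
qed simp

lemma partial_op_funpow_single:
  "(partial_op v ^^ k) (single a c) = single (a - single v k)
    (of_nat (\<Prod>i<k. lookup a v - i) * c)"
proof (induction k)
  case (Suc k)
  have "a - single v k - unit_exp v = a - single v (Suc k)"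
    by (rule poly_mapping_eqI) (auto simp: lookup_minus lookup_single when_def)
  with Suc show ?case by (simp add: partial_op_single lookup_minus mult_ac)
qed simp

text \<open>Identities between the diagonal operators below are checked on monomials.\<close>

lemma weyl_eqI:
  assumes "P \<in> carrier weyl_algebra" "Q \<in> carrier weyl_algebra"
    and "\<And>a c. P (single a c) = Q (single a c)"
  shows "P = Q"
proof
  fix p show "P p = Q p"
    by (induction p rule: poly_mapping_single_add_induct) (simp_all add: assms weyl_linear(1))
qed

text \<open>On a monomial of exponent \<open>n\<close> in \<open>z\<close> the operator \<open>z\<^sup>k\<partial>\<^sup>k\<close> acts by the falling factorial of \<open>n\<close>, and
  \<open>\<partial>\<^sup>kz\<^sup>k\<close> by the rising one of \<open>n + 1\<close>. The recursions of these factorials become factorisations through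
  the Euler operator \<open>z\<partial>\<close>, which are valid in every module.\<close>

lemma var_partial_funpow_Suc:
  "(var_op v ^^ Suc k) \<circ> (partial_op v ^^ Suc k) =
    ((var_op v ^^ k) \<circ> (partial_op v ^^ k)) \<circ> (\<lambda>p. (var_op v \<circ> partial_op v) p + scalar_op (- of_nat k) p)"
proof (rule weyl_eqI)
  have diag: "((var_op v ^^ j) \<circ> (partial_op v ^^ j)) (single a c) =
      single a (of_nat (\<Prod>i<j. lookup a v - i) * c)" for j and a :: "'a \<Rightarrow>\<^sub>0 nat" and c :: complex
  proof (cases "j \<le> lookup a v")
    case True
    then have "single v j + (a - single v j) = a"
      by (intro poly_mapping_eqI) (auto simp: lookup_add lookup_minus lookup_single when_def)
    then show ?thesis unfolding o_apply partial_op_funpow_single var_op_funpow_single by (simp only:)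
  next
    case False
    then have zero: "(\<Prod>i<j. lookup a v - i) = 0" by (intro prod_zero) (auto intro!: bexI[of _ "lookup a v"])
    show ?thesis unfolding o_apply partial_op_funpow_single var_op_funpow_single zero by simp
  qed
  fix a :: "'a \<Rightarrow>\<^sub>0 nat" and c :: complex
  let ?n = "lookup a v"
  let ?f = "\<Prod>i<k. ?n - i"
  have zero: "of_nat ?f * of_nat (?n - k) = (of_nat ?f * (of_nat ?n - of_nat k) :: complex)"
  proof (cases "k \<le> ?n")
    case False
    then have f0: "?f = 0" by (intro prod_zero) (auto intro!: bexI[of _ ?n])
    show ?thesis unfolding f0 by simp
  qed (simp add: of_nat_diff del: of_nat_prod)
  have th: "(\<lambda>p. (var_op v \<circ> partial_op v) p + scalar_op (- of_nat k) p) (single a c) =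
      single a ((of_nat ?n - of_nat k) * c)"
    using diag[of 1 a c] by (simp add: scalar_op_single single_add[symmetric] single_diff[symmetric] One_nat_def algebra_simps)
  show "((var_op v ^^ Suc k) \<circ> (partial_op v ^^ Suc k)) (single a c) =
    (((var_op v ^^ k) \<circ> (partial_op v ^^ k)) \<circ>
      (\<lambda>p. (var_op v \<circ> partial_op v) p + scalar_op (- of_nat k) p)) (single a c)"
    unfolding o_apply[of "(var_op v ^^ k) \<circ> (partial_op v ^^ k)"] th diag prod.lessThan_Suc of_nat_mult
    by (metis zero mult.assoc)
qed (intro weyl_closed weyl_funpow weyl_mem)+

lemma partial_var_funpow_Suc:
  "(partial_op v ^^ Suc k) \<circ> (var_op v ^^ Suc k) =
    ((partial_op v ^^ k) \<circ> (var_op v ^^ k)) \<circ> (\<lambda>p. (var_op v \<circ> partial_op v) p + scalar_op (of_nat (Suc k)) p)"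
proof (rule weyl_eqI)
  have diag: "((partial_op v ^^ j) \<circ> (var_op v ^^ j)) (single a c) =
      single a (of_nat (\<Prod>i<j. j + lookup a v - i) * c)" for j and a :: "'a \<Rightarrow>\<^sub>0 nat" and c :: complex
    by (simp add: var_op_funpow_single partial_op_funpow_single lookup_add del: of_nat_prod)
  fix a :: "'a \<Rightarrow>\<^sub>0 nat" and c :: complex
  let ?n = "lookup a v"
  have th: "(\<lambda>p. (var_op v \<circ> partial_op v) p + scalar_op (of_nat (Suc k)) p) (single a c) =
      single a (of_nat (Suc k + ?n) * c)"
  proof (cases "?n = 0")
    case False
    then show ?thesis
      by (simp add: scalar_op_single partial_op_single var_op_single unit_exp_diff_add single_add[symmetric] algebra_simps)
  qed (simp add: scalar_op_single partial_op_single weyl_apply_0[OF weyl_mem(2)])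
  have "(\<Prod>i<Suc k. Suc k + ?n - i) = (Suc k + ?n) * (\<Prod>i<k. k + ?n - i)"
    by (subst prod.lessThan_Suc_shift) simp
  then show "((partial_op v ^^ Suc k) \<circ> (var_op v ^^ Suc k)) (single a c) =
    (((partial_op v ^^ k) \<circ> (var_op v ^^ k)) \<circ>
      (\<lambda>p. (var_op v \<circ> partial_op v) p + scalar_op (of_nat (Suc k)) p)) (single a c)"
    unfolding o_apply[of "(partial_op v ^^ k) \<circ> (var_op v ^^ k)"] th diag
    by (simp only: of_nat_mult mult_ac)
qed (intro weyl_closed weyl_funpow weyl_mem)+

context weyl_module
begin

lemma smult_scalar_scalar:
  "x \<in> carrier M \<Longrightarrow> scalar_op b \<odot>\<^bsub>M\<^esub> (scalar_op c \<odot>\<^bsub>M\<^esub> x) = scalar_op (b * c) \<odot>\<^bsub>M\<^esub> x"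
  using smult_comp[OF weyl_mem(1) weyl_mem(1), of x b c] by (simp add: comp_def scalar_op_scalar_op)

lemma smult_scalar_plus:
  "x \<in> carrier M \<Longrightarrow> scalar_op (b + c) \<odot>\<^bsub>M\<^esub> x = scalar_op b \<odot>\<^bsub>M\<^esub> x \<oplus>\<^bsub>M\<^esub> scalar_op c \<odot>\<^bsub>M\<^esub> x"
  using smult_plus[OF weyl_mem(1) weyl_mem(1), of x b c] by (simp add: scalar_op_plus[symmetric])

lemma smult_scalar_commute:
  assumes "P \<in> carrier weyl_algebra" "x \<in> carrier M"
  shows "P \<odot>\<^bsub>M\<^esub> (scalar_op c \<odot>\<^bsub>M\<^esub> x) = scalar_op c \<odot>\<^bsub>M\<^esub> (P \<odot>\<^bsub>M\<^esub> x)"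
proof -
  have "P \<circ> scalar_op c = scalar_op c \<circ> P" by (simp add: fun_eq_iff weyl_linear(2)[OF assms(1)])
  then show ?thesis using assms weyl_mem(1) by (metis smult_comp)
qed

lemma euler_eigenvector_powers:
  assumes u: "u \<in> carrier M" and ev: "(var_op v \<circ> partial_op v) \<odot>\<^bsub>M\<^esub> u = scalar_op t \<odot>\<^bsub>M\<^esub> u"
  shows "((var_op v ^^ k) \<circ> (partial_op v ^^ k)) \<odot>\<^bsub>M\<^esub> u = scalar_op (\<Prod>i<k. t - of_nat i) \<odot>\<^bsub>M\<^esub> u"
    and "((partial_op v ^^ k) \<circ> (var_op v ^^ k)) \<odot>\<^bsub>M\<^esub> u = scalar_op (\<Prod>i<k. t + of_nat (Suc i)) \<odot>\<^bsub>M\<^esub> u"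
proof -
  have shift: "(\<lambda>p. (var_op v \<circ> partial_op v) p + scalar_op s p) \<odot>\<^bsub>M\<^esub> u = scalar_op (t + s) \<odot>\<^bsub>M\<^esub> u" for s
    unfolding smult_scalar_plus[OF u] ev[symmetric]
    by (intro smult_plus weyl_closed weyl_mem u)
  have mem: "(\<lambda>p. (var_op v \<circ> partial_op v) p + scalar_op s p) \<in> carrier weyl_algebra" for s
    by (intro weyl_closed weyl_mem)
  have mem': "(var_op v ^^ k) \<circ> (partial_op v ^^ k) \<in> carrier weyl_algebra"
    "(partial_op v ^^ k) \<circ> (var_op v ^^ k) \<in> carrier weyl_algebra" for k
    by (intro weyl_closed weyl_funpow weyl_mem)+
  show "((var_op v ^^ k) \<circ> (partial_op v ^^ k)) \<odot>\<^bsub>M\<^esub> u = scalar_op (\<Prod>i<k. t - of_nat i) \<odot>\<^bsub>M\<^esub> u"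
  proof (induction k)
    case 0
    show ?case using smult_id[OF u] by (simp add: id_def)
  next
    case (Suc k)
    show ?case
      unfolding var_partial_funpow_Suc smult_comp[OF mem'(1) mem u] shift
        smult_scalar_commute[OF mem'(1) u] Suc smult_scalar_scalar[OF u]
      by (simp add: mult.commute)
  qed
  show "((partial_op v ^^ k) \<circ> (var_op v ^^ k)) \<odot>\<^bsub>M\<^esub> u = scalar_op (\<Prod>i<k. t + of_nat (Suc i)) \<odot>\<^bsub>M\<^esub> u"
  proof (induction k)
    case 0
    show ?case using smult_id[OF u] by (simp add: id_def)
  next
    case (Suc k)
    show ?case
      unfolding partial_var_funpow_Suc smult_comp[OF mem'(2) mem u] shift
        smult_scalar_commute[OF mem'(2) u] Suc smult_scalar_scalar[OF u]
      by (simp add: mult.commute)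
  qed
qed

end

context vacuum_vector
begin

lemma partial_op_funpow_state: "v \<notin> F \<Longrightarrow> (partial_op v ^^ k) \<odot>\<^bsub>M\<^esub> state p = state ((partial_op v ^^ k) p)"
proof (induction k)
  case 0
  show ?case using smult_id[OF state_mem] by (simp add: id_def)
next
  case (Suc k)
  show ?case
    unfolding funpow.simps(2) smult_comp[OF weyl_mem(3) weyl_funpow[OF weyl_mem(3)] state_mem]
      Suc.IH[OF Suc.prems] o_apply[of "partial_op v" "partial_op v ^^ k" p]
    using Suc.prems by (simp add: partial_op_state)
qed

lemma var_op_funpow_state:
  "v \<in> F \<Longrightarrow> (var_op v ^^ k) \<odot>\<^bsub>M\<^esub> state p = state (scalar_op ((-1) ^ k) ((partial_op v ^^ k) p))"
proof (induction k)
  case 0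
  show ?case using smult_id[OF state_mem] by (simp add: id_def)
next
  case (Suc k)
  show ?case
    unfolding funpow.simps(2) smult_comp[OF weyl_mem(2) weyl_funpow[OF weyl_mem(2)] state_mem]
      Suc.IH[OF Suc.prems] o_apply[of "partial_op v" "partial_op v ^^ k" p]
    using Suc.prems by (simp add: var_op_state scalar_op_commute_partial[symmetric] scalar_op_uminus)
qed

end


section \<open>The isomorphism between \<open>\<M>\<^sub>1\<^sub>l\<close> and \<open>\<B>\<^bsub>Y|X\<^esub>\<close>\<close>

abbreviation J_Y :: "coord pop set"
  where "J_Y \<equiv> left_ideal_gen \<D> {\<partial> Z1, zvar Z2, \<partial> Z3, zvar Z4}"

interpretation J_Y: weyl_left_ideal J_Y
  by (intro weyl_left_idealI weyl.left_ideal_left_ideal_gen) (auto simp: weyl_mem)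

lemma J_Y_generators: "\<partial> Z1 \<in> J_Y" "zvar Z2 \<in> J_Y" "\<partial> Z3 \<in> J_Y" "zvar Z4 \<in> J_Y"
  by (rule subsetD[OF left_ideal_gen_incl], simp)+

lemma J_Y_proper: "id \<notin> J_Y"
proof -
  obtain I :: "coord pop set" where I: "left_ideal I weyl_algebra" "\<And>v. v \<notin> {Z2, Z4} \<Longrightarrow> \<partial> v \<in> I"
    "\<And>v. v \<in> {Z2, Z4} \<Longrightarrow> zvar v \<in> I" "id \<notin> I"
    by (rule ex_proper_left_ideal_vacuum[of "{Z2, Z4}"], rule that, blast+)
  have "J_Y \<subseteq> I" by (rule left_ideal_gen_least[OF I(1)]) (use I(2,3) in auto)
  with I(4) show ?thesis by blast
qed

lemma annihilation_in_J_Y: "annihilation {Z2, Z4} v \<in> J_Y"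
  by (cases v) (auto simp: annihilation_def J_Y_generators J_Y.ideal_comp weyl_mem)

interpretation B: vacuum_vector B_YX "{Z2, Z4}" \<delta>
proof -
  interpret weyl_module B_YX unfolding B_YX_def by (rule J_Y.quotient.weyl_module_axioms)
  show "vacuum_vector B_YX {Z2, Z4} \<delta>"
  proof
    show "\<delta> \<in> carrier B_YX" unfolding delta_def B_YX_def weyl_ops by (rule J_Y.coset_mem[OF weyl_id])
    fix v
    show "annihilation {Z2, Z4} v \<odot>\<^bsub>B_YX\<^esub> \<delta> = \<zero>\<^bsub>B_YX\<^esub>"
      unfolding delta_def B_YX_def weyl_ops J_Y.smult_coset[OF annihilation_mem weyl_id] o_id
        J_Y.coset_eq_zero_iff[OF annihilation_mem]
      by (rule annihilation_in_J_Y)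
  qed
qed

lemma smult_delta_eq_0_iff:
  "P \<in> carrier \<D> \<Longrightarrow> P \<odot>\<^bsub>B_YX\<^esub> \<delta> = \<zero>\<^bsub>B_YX\<^esub> \<longleftrightarrow> P \<in> J_Y"
  unfolding delta_def B_YX_def weyl_ops
  by (simp only: J_Y.smult_coset[OF _ weyl_id] o_id J_Y.coset_eq_zero_iff)

definition I1_generators :: "nat \<Rightarrow> coord pop set"
  where "I1_generators l =
    {\<lambda>p. (zvar Z1 \<circ> \<partial> Z1) p + scalar_op (- of_nat l) p, \<partial> Z1 ^^ Suc l,
     \<lambda>p. (zvar Z2 \<circ> \<partial> Z2) p + scalar_op (of_nat (Suc l)) p, zvar Z2 ^^ Suc l, \<partial> Z3, zvar Z4}"

lemma I1_generators_weyl: "I1_generators l \<subseteq> carrier \<D>"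
  unfolding I1_generators_def
  by (intro insert_subsetI empty_subsetI weyl_closed weyl_mem weyl_funpow)

lemma I1_eq: "I1 l = left_ideal_gen \<D> (I1_generators l)"
proof -
  have "zvar Z1 \<otimes>\<^bsub>\<D>\<^esub> \<partial> Z1 \<ominus>\<^bsub>\<D>\<^esub> scalar_op (of_nat l) = (\<lambda>p. (zvar Z1 \<circ> \<partial> Z1) p + scalar_op (- of_nat l) p)"
    by (simp add: weyl_minus weyl_mem scalar_op_uminus weyl_ops(1))
  then show ?thesis
    unfolding I1_def I1_generators_def by (simp only: weyl_ops weyl_pow Suc_eq_plus1)
qed

interpretation I1: weyl_left_ideal "I1 l" for l
  unfolding I1_eq by (intro weyl_left_idealI weyl.left_ideal_left_ideal_gen I1_generators_weyl)

lemma I1_mem: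
  "(\<lambda>p. (zvar Z1 \<circ> \<partial> Z1) p + scalar_op (- of_nat l) p) \<in> I1 l" "\<partial> Z1 ^^ Suc l \<in> I1 l"
  "(\<lambda>p. (zvar Z2 \<circ> \<partial> Z2) p + scalar_op (of_nat (Suc l)) p) \<in> I1 l" "zvar Z2 ^^ Suc l \<in> I1 l"
  "\<partial> Z3 \<in> I1 l" "zvar Z4 \<in> I1 l"
  unfolding I1_eq
  by (rule subsetD[OF left_ideal_gen_incl], simp only: I1_generators_def insert_iff simp_thms)+

text \<open>Right multiplication by these two operators induces the isomorphism with \<open>\<B>\<^bsub>Y|X\<^esub>\<close> and, up to a
  scalar, its inverse.\<close>

definition fwd_op :: "nat \<Rightarrow> coord pop"
  where "fwd_op l = (zvar Z1 \<circ> \<partial> Z2) ^^ l"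

definition bwd_op :: "nat \<Rightarrow> coord pop"
  where "bwd_op l = (\<partial> Z1 ^^ l) \<circ> (zvar Z2 ^^ l)"

lemma fwd_op_mem: "fwd_op l \<in> carrier \<D>"
  unfolding fwd_op_def by (intro weyl_closed weyl_mem weyl_funpow)

lemma bwd_op_mem: "bwd_op l \<in> carrier \<D>"
  unfolding bwd_op_def by (intro weyl_closed weyl_mem weyl_funpow)

definition gen_exp :: "nat \<Rightarrow> (coord \<Rightarrow>\<^sub>0 nat)"
  where "gen_exp l = single Z1 l + single Z2 l"

lemma lookup_gen_exp: "lookup (gen_exp l) v = (if v = Z1 \<or> v = Z2 then l else 0)"
  by (auto simp: gen_exp_def lookup_add lookup_single when_def)

lemma fwd_op_delta: "fwd_op l \<odot>\<^bsub>B_YX\<^esub> \<delta> = B.state (single (gen_exp l) 1)"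
proof (induction l)
  case 0
  have "fwd_op 0 \<odot>\<^bsub>B_YX\<^esub> \<delta> = \<delta>"
    unfolding fwd_op_def funpow.simps(1) by (rule B.smult_id[OF B.vacuum_mem])
  also have "\<dots> = B.state 1" by (rule B.state_1[symmetric])
  also have "(1 :: coord cpoly) = single (gen_exp 0) 1" by (simp add: gen_exp_def)
  finally show ?case .
next
  case (Suc l)
  have mem: "zvar Z1 \<circ> \<partial> Z2 \<in> carrier \<D>" by (intro weyl_closed weyl_mem)
  have "fwd_op (Suc l) \<odot>\<^bsub>B_YX\<^esub> \<delta> = (zvar Z1 \<circ> \<partial> Z2) \<odot>\<^bsub>B_YX\<^esub> (fwd_op l \<odot>\<^bsub>B_YX\<^esub> \<delta>)"
    unfolding fwd_op_def funpow.simps(2)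
    by (rule B.smult_comp[OF mem weyl_funpow[OF mem] B.vacuum_mem])
  also have "\<dots> = zvar Z1 \<odot>\<^bsub>B_YX\<^esub> (\<partial> Z2 \<odot>\<^bsub>B_YX\<^esub> B.state (single (gen_exp l) 1))"
    unfolding Suc by (rule B.smult_comp[OF weyl_mem(2) weyl_mem(3) B.state_mem])
  also have "\<dots> = B.state (single (unit_exp Z1 + (unit_exp Z2 + gen_exp l)) 1)"
    by (simp add: B.var_op_state B.partial_op_state var_op_single)
  also have "unit_exp Z1 + (unit_exp Z2 + gen_exp l) = gen_exp (Suc l)"
    by (rule poly_mapping_eqI) (auto simp: lookup_add lookup_gen_exp lookup_single when_def)
  finally show ?case .
qed

lemma prod_diff_funpow: "(\<Prod>i<n. n - i) = fact n"
  by (metis fact_prod_rev lessThan_atLeast0 of_nat_id)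

text \<open>In terms of polynomials, \<open>(z\<^sub>1\<partial>\<^sub>2)\<^sup>l \<delta>\<close> is the monomial \<open>z\<^sub>1\<^sup>l z\<^sub>2\<^sup>l\<close>, with \<open>z\<^sub>1\<partial>\<^sub>1\<close> acting as
  itself and \<open>z\<^sub>2\<partial>\<^sub>2\<close> as \<open>-\<partial>\<^sub>2z\<^sub>2\<close>; the generators of the ideal express its degrees in the two variables and its
  independence of the others.\<close>

lemma I1_annihilates:
  assumes "P \<in> I1 l"
  shows "P \<odot>\<^bsub>B_YX\<^esub> (fwd_op l \<odot>\<^bsub>B_YX\<^esub> \<delta>) = \<zero>\<^bsub>B_YX\<^esub>"
proof -
  let ?m = "single (gen_exp l) (1::complex)"
  let ?x = "B.state ?m"
  have Z: "var_op v \<odot>\<^bsub>B_YX\<^esub> B.state p = B.state (if v \<in> {Z2, Z4} then - partial_op v p else var_op v p)" 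
    "partial_op v \<odot>\<^bsub>B_YX\<^esub> B.state p = B.state (if v \<in> {Z2, Z4} then var_op v p else partial_op v p)" for v p
    by (rule B.var_op_state B.partial_op_state)+
  have "(\<lambda>p. (zvar Z1 \<circ> \<partial> Z1) p + scalar_op (- of_nat l) p) \<odot>\<^bsub>B_YX\<^esub> ?x = \<zero>\<^bsub>B_YX\<^esub>"
  proof -
    have "(\<lambda>p. (zvar Z1 \<circ> \<partial> Z1) p + scalar_op (- of_nat l) p) \<odot>\<^bsub>B_YX\<^esub> ?x =
        zvar Z1 \<odot>\<^bsub>B_YX\<^esub> (\<partial> Z1 \<odot>\<^bsub>B_YX\<^esub> ?x) \<oplus>\<^bsub>B_YX\<^esub> scalar_op (- of_nat l) \<odot>\<^bsub>B_YX\<^esub> ?x"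
      unfolding B.smult_comp[OF weyl_mem(2) weyl_mem(3) B.state_mem, symmetric]
      by (intro B.smult_plus weyl_closed weyl_mem B.state_mem)
    also have "\<dots> = B.state (var_op Z1 (partial_op Z1 ?m) + scalar_op (- of_nat l) ?m)"
      unfolding Z B.state_scalar[symmetric] by (simp add: B.state_add del: add_uminus_conv_diff uminus_add_conv_diff)
    also have "var_op Z1 (partial_op Z1 ?m) + scalar_op (- of_nat l) ?m = 0"
      by (cases "l = 0")
        (simp_all add: partial_op_single lookup_gen_exp scalar_op_single weyl_apply_0[OF weyl_mem(2)]
          var_op_single unit_exp_diff_add single_add[symmetric])
    finally show ?thesis unfolding B.state_0 .
  qed
  moreover have "(\<partial> Z1 ^^ Suc l) \<odot>\<^bsub>B_YX\<^esub> ?x = \<zero>\<^bsub>B_YX\<^esub>"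
    by (subst B.partial_op_funpow_state)
      (simp_all add: partial_op_funpow_single lookup_gen_exp B.state_0 del: funpow.simps)
  moreover have "(\<lambda>p. (zvar Z2 \<circ> \<partial> Z2) p + scalar_op (of_nat (Suc l)) p) \<odot>\<^bsub>B_YX\<^esub> ?x = \<zero>\<^bsub>B_YX\<^esub>"
  proof -
    have "(\<lambda>p. (zvar Z2 \<circ> \<partial> Z2) p + scalar_op (of_nat (Suc l)) p) \<odot>\<^bsub>B_YX\<^esub> ?x =
        zvar Z2 \<odot>\<^bsub>B_YX\<^esub> (\<partial> Z2 \<odot>\<^bsub>B_YX\<^esub> ?x) \<oplus>\<^bsub>B_YX\<^esub> scalar_op (of_nat (Suc l)) \<odot>\<^bsub>B_YX\<^esub> ?x"
      unfolding B.smult_comp[OF weyl_mem(2) weyl_mem(3) B.state_mem, symmetric]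
      by (intro B.smult_plus weyl_closed weyl_mem B.state_mem)
    also have "\<dots> = B.state (- partial_op Z2 (var_op Z2 ?m) + scalar_op (of_nat (Suc l)) ?m)"
      unfolding Z B.state_scalar[symmetric] by (simp add: B.state_add del: add_uminus_conv_diff uminus_add_conv_diff)
    also have "- partial_op Z2 (var_op Z2 ?m) + scalar_op (of_nat (Suc l)) ?m = 0"
      by (simp add: partial_op_single var_op_single lookup_add lookup_gen_exp scalar_op_single)
    finally show ?thesis unfolding B.state_0 .
  qed
  moreover have "(zvar Z2 ^^ Suc l) \<odot>\<^bsub>B_YX\<^esub> ?x = \<zero>\<^bsub>B_YX\<^esub>"
    by (subst B.var_op_funpow_state)
      (simp_all add: partial_op_funpow_single lookup_gen_exp B.state_0 weyl_apply_0[OF weyl_mem(1)] del: funpow.simps)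
  moreover have "\<partial> Z3 \<odot>\<^bsub>B_YX\<^esub> ?x = \<zero>\<^bsub>B_YX\<^esub>" "zvar Z4 \<odot>\<^bsub>B_YX\<^esub> ?x = \<zero>\<^bsub>B_YX\<^esub>"
    unfolding Z by (simp_all add: partial_op_single lookup_gen_exp B.state_0)
  ultimately have "I1_generators l \<subseteq> {P \<in> carrier \<D>. P \<odot>\<^bsub>B_YX\<^esub> ?x = \<zero>\<^bsub>B_YX\<^esub>}"
    using I1_generators_weyl[of l] unfolding I1_generators_def by blast
  with B.annihilator_left_ideal[OF B.state_mem]
  have "I1 l \<subseteq> {P \<in> carrier \<D>. P \<odot>\<^bsub>B_YX\<^esub> ?x = \<zero>\<^bsub>B_YX\<^esub>}"
    unfolding I1_eq by (rule left_ideal_gen_least)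
  with assms show ?thesis unfolding fwd_op_delta by blast
qed

lemma I1_fwd_op:
  assumes "P \<in> I1 l"
  shows "P \<circ> fwd_op l \<in> J_Y"
proof -
  have P: "P \<in> carrier \<D>" using assms by (rule I1.ideal_weyl)
  have "(P \<circ> fwd_op l) \<odot>\<^bsub>B_YX\<^esub> \<delta> = \<zero>\<^bsub>B_YX\<^esub>"
    using I1_annihilates[OF assms] B.smult_comp[OF P fwd_op_mem B.vacuum_mem] by simp
  then show ?thesis using smult_delta_eq_0_iff[OF weyl_closed(1)[OF P fwd_op_mem]] by blast
qed

definition norm_const :: "nat \<Rightarrow> complex"
  where "norm_const l = (-1) ^ l * (fact l)\<^sup>2"

lemma norm_const_nonzero: "norm_const l \<noteq> 0"
  by (simp add: norm_const_def)

text \<open>In terms of polynomials this is \<open>\<partial>\<^sub>1\<^sup>l (-\<partial>\<^sub>2)\<^sup>l (z\<^sub>1\<^sup>l z\<^sub>2\<^sup>l) = (-1)\<^sup>l (l!)\<^sup>2\<close>.\<close>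

lemma bwd_fwd_op: "(\<lambda>p. (bwd_op l \<circ> fwd_op l) p + scalar_op (- norm_const l) p) \<in> J_Y"
proof -
  let ?m = "single (gen_exp l) (1::complex)"
  have mem: "bwd_op l \<circ> fwd_op l \<in> carrier \<D>" by (intro weyl_closed fwd_op_mem bwd_op_mem)
  have "(bwd_op l \<circ> fwd_op l) \<odot>\<^bsub>B_YX\<^esub> \<delta> = bwd_op l \<odot>\<^bsub>B_YX\<^esub> B.state ?m"
    unfolding fwd_op_delta[symmetric] by (rule B.smult_comp[OF bwd_op_mem fwd_op_mem B.vacuum_mem])
  also have "\<dots> = (\<partial> Z1 ^^ l) \<odot>\<^bsub>B_YX\<^esub> ((zvar Z2 ^^ l) \<odot>\<^bsub>B_YX\<^esub> B.state ?m)"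
    unfolding bwd_op_def by (intro B.smult_comp weyl_funpow weyl_mem B.state_mem)
  also have "\<dots> = B.state ((\<partial> Z1 ^^ l) (scalar_op ((-1) ^ l) ((\<partial> Z2 ^^ l) ?m)))"
    by (subst B.var_op_funpow_state, simp, subst B.partial_op_funpow_state) simp_all
  also have "(\<partial> Z1 ^^ l) (scalar_op ((-1) ^ l) ((\<partial> Z2 ^^ l) ?m)) =
      single (gen_exp l - single Z2 l - single Z1 l) (norm_const l)"
    unfolding partial_op_funpow_single scalar_op_single
    by (simp add: lookup_minus lookup_gen_exp lookup_single prod_diff_funpow norm_const_def power2_eq_square
        mult_ac del: of_nat_prod)
  also have "gen_exp l - single Z2 l - single Z1 l = 0"
    by (rule poly_mapping_eqI) (simp add: lookup_minus lookup_gen_exp lookup_single when_def)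
  also have "B.state (single 0 (norm_const l)) = scalar_op (norm_const l) \<odot>\<^bsub>B_YX\<^esub> \<delta>"
    using B.state_scalar[of "norm_const l" 1] by (simp only: scalar_op_def mult_1_right B.state_1)
  finally have eq: "(bwd_op l \<circ> fwd_op l) \<odot>\<^bsub>B_YX\<^esub> \<delta> = scalar_op (norm_const l) \<odot>\<^bsub>B_YX\<^esub> \<delta>" .
  have "(\<lambda>p. (bwd_op l \<circ> fwd_op l) p + scalar_op (- norm_const l) p) \<odot>\<^bsub>B_YX\<^esub> \<delta> = \<zero>\<^bsub>B_YX\<^esub>"
    unfolding B.smult_plus[OF mem weyl_mem(1) B.vacuum_mem] eq B.smult_scalar_plus[OF B.vacuum_mem, symmetric]
    by (simp add: B.smult_0[OF B.vacuum_mem])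
  then show ?thesis
    using smult_delta_eq_0_iff[OF weyl_closed(2)[OF mem weyl_mem(1)]] by blast
qed

text \<open>The operators that kill \<open>\<delta>\<close> commute with all factors of \<open>\<partial>\<^sub>1\<^sup>l z\<^sub>2\<^sup>l\<close> that they have to pass, and
  arrive at one of the generators of \<open>\<I>\<^sub>1\<^sub>l\<close>.\<close>

lemma J_Y_bwd_op:
  assumes "P \<in> J_Y"
  shows "P \<circ> bwd_op l \<in> I1 l"
proof -
  have comm: "f \<circ> (g ^^ k) = (g ^^ k) \<circ> f" if "f \<circ> g = g \<circ> f" for f g :: "coord pop" and k
    using funpow_commute_funpow[OF that, of 1 k] by (simp add: One_nat_def)
  have dz: "\<partial> u \<circ> zvar v = zvar v \<circ> \<partial> u" if "u \<noteq> v" for u v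
    using that by (simp add: fun_eq_iff partial_op_var_op)
  have dd: "\<partial> u \<circ> \<partial> v = \<partial> v \<circ> \<partial> u" for u v by (simp add: fun_eq_iff partial_op_commute)
  have zz: "zvar u \<circ> zvar v = zvar v \<circ> zvar u" for u v by (simp add: fun_eq_iff var_op_commute)
  have "\<partial> Z1 \<circ> bwd_op l = (zvar Z2 ^^ l) \<circ> (\<partial> Z1 ^^ Suc l)"
  proof -
    have "\<partial> Z1 \<circ> bwd_op l = (\<partial> Z1 ^^ Suc l) \<circ> (zvar Z2 ^^ l)"
      unfolding bwd_op_def funpow.simps(2) by (rule o_assoc)
    also have "\<dots> = (zvar Z2 ^^ l) \<circ> (\<partial> Z1 ^^ Suc l)"
      by (rule funpow_commute_funpow) (rule dz, simp)
    finally show ?thesis .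
  qed
  then have "\<partial> Z1 \<circ> bwd_op l \<in> I1 l"
    using I1.ideal_comp[OF weyl_funpow[OF weyl_mem(2)] I1_mem(2)] by metis
  moreover have "zvar Z2 \<circ> bwd_op l = (\<partial> Z1 ^^ l) \<circ> (zvar Z2 ^^ Suc l)"
  proof -
    have "zvar Z2 \<circ> bwd_op l = (zvar Z2 \<circ> (\<partial> Z1 ^^ l)) \<circ> (zvar Z2 ^^ l)"
      unfolding bwd_op_def by (rule o_assoc)
    also have "zvar Z2 \<circ> (\<partial> Z1 ^^ l) = (\<partial> Z1 ^^ l) \<circ> zvar Z2"
      by (rule comm, rule dz[symmetric]) simp
    finally show ?thesis unfolding funpow.simps(2) by (simp only: o_assoc)
  qed
  then have "zvar Z2 \<circ> bwd_op l \<in> I1 l"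
    using I1.ideal_comp[OF weyl_funpow[OF weyl_mem(3)] I1_mem(4)] by metis
  moreover have "\<partial> Z3 \<circ> bwd_op l \<in> I1 l"
  proof -
    have "\<partial> Z3 \<circ> bwd_op l = (\<partial> Z3 \<circ> (\<partial> Z1 ^^ l)) \<circ> (zvar Z2 ^^ l)"
      unfolding bwd_op_def by (rule o_assoc)
    also have "\<dots> = (\<partial> Z1 ^^ l) \<circ> (\<partial> Z3 \<circ> (zvar Z2 ^^ l))"
      unfolding comm[OF dd] by (simp only: o_assoc)
    also have "\<dots> = bwd_op l \<circ> \<partial> Z3"
      unfolding bwd_op_def by (subst comm[OF dz]) (simp_all only: o_assoc coord.distinct not_False_eq_True)
    finally show ?thesis using I1.ideal_comp[OF bwd_op_mem I1_mem(5)] by metis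
  qed
  moreover have "zvar Z4 \<circ> bwd_op l \<in> I1 l"
  proof -
    have "zvar Z4 \<circ> bwd_op l = (zvar Z4 \<circ> (\<partial> Z1 ^^ l)) \<circ> (zvar Z2 ^^ l)"
      unfolding bwd_op_def by (rule o_assoc)
    also have "\<dots> = (\<partial> Z1 ^^ l) \<circ> (zvar Z4 \<circ> (zvar Z2 ^^ l))"
      by (subst comm[OF dz[symmetric]]) (simp_all only: o_assoc coord.distinct not_False_eq_True)
    also have "\<dots> = bwd_op l \<circ> zvar Z4"
      unfolding bwd_op_def comm[OF zz] by (simp only: o_assoc)
    finally show ?thesis using I1.ideal_comp[OF bwd_op_mem I1_mem(6)] by metis
  qed
  ultimately have "{\<partial> Z1, zvar Z2, \<partial> Z3, zvar Z4} \<subseteq> {P \<in> carrier \<D>. P \<otimes>\<^bsub>\<D>\<^esub> bwd_op l \<in> I1 l}"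
    by (simp add: weyl_ops(1) weyl_mem)
  then have "J_Y \<subseteq> {P \<in> carrier \<D>. P \<otimes>\<^bsub>\<D>\<^esub> bwd_op l \<in> I1 l}"
    by (rule left_ideal_gen_least[OF weyl.left_ideal_right_quotient[OF I1.left_ideal bwd_op_mem]])
  with assms show ?thesis by (auto simp: weyl_ops(1))
qed

text \<open>Regrouped, the operator is \<open>(z\<^sub>1\<^sup>l \<partial>\<^sub>1\<^sup>l) (\<partial>\<^sub>2\<^sup>l z\<^sub>2\<^sup>l)\<close>. On the generator of the quotient, where the two
  Euler operators have the eigenvalues \<open>l\<close> and \<open>-(l + 1)\<close>, the factors act by \<open>l!\<close> and \<open>(-1)\<^sup>l l!\<close>.\<close>

lemma fwd_bwd_op: "(\<lambda>p. (fwd_op l \<circ> bwd_op l) p + scalar_op (- norm_const l) p) \<in> I1 l"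
proof -
  let ?M = "quotient_left_module \<D> (I1 l)"
  let ?u = "I1 l +>\<^bsub>\<D>\<^esub> id"
  have u: "?u \<in> carrier ?M" by (rule I1.coset_mem[OF weyl_id])
  have ev: "P \<odot>\<^bsub>?M\<^esub> ?u = scalar_op t \<odot>\<^bsub>?M\<^esub> ?u \<longleftrightarrow> (\<lambda>p. P p + scalar_op (- t) p) \<in> I1 l"
    if P: "P \<in> carrier \<D>" for P t
    by (simp only: I1.smult_coset[OF P weyl_id] I1.smult_coset[OF weyl_mem(1) weyl_id] o_id
        I1.coset_eq[OF P weyl_mem(1)] scalar_op_uminus add_uminus_conv_diff)
  have mem: "zvar v \<circ> \<partial> v \<in> carrier \<D>" for v by (intro weyl_closed weyl_mem)
  have ev1: "(zvar Z1 \<circ> \<partial> Z1) \<odot>\<^bsub>?M\<^esub> ?u = scalar_op (of_nat l) \<odot>\<^bsub>?M\<^esub> ?u"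
    unfolding ev[OF mem] by (rule I1_mem(1))
  have ev2: "(zvar Z2 \<circ> \<partial> Z2) \<odot>\<^bsub>?M\<^esub> ?u = scalar_op (- of_nat (Suc l)) \<odot>\<^bsub>?M\<^esub> ?u"
    unfolding ev[OF mem] minus_minus by (rule I1_mem(3))
  let ?E1 = "(zvar Z1 ^^ l) \<circ> (\<partial> Z1 ^^ l)" and ?E2 = "(\<partial> Z2 ^^ l) \<circ> (zvar Z2 ^^ l)"
  have mem': "?E1 \<in> carrier \<D>" "?E2 \<in> carrier \<D>" by (intro weyl_closed weyl_funpow weyl_mem)+
  have comm: "\<partial> Z2 \<circ> zvar Z1 = zvar Z1 \<circ> \<partial> Z2" by (simp add: fun_eq_iff partial_op_var_op)
  have A: "fwd_op k = (zvar Z1 ^^ k) \<circ> (\<partial> Z2 ^^ k)" for k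
  proof (induction k)
    case (Suc k)
    have c: "\<partial> Z2 \<circ> (zvar Z1 ^^ k) = (zvar Z1 ^^ k) \<circ> \<partial> Z2"
      using funpow_commute_funpow[OF comm, of 1 k] by (simp only: One_nat_def funpow.simps o_id)
    have "fwd_op (Suc k) = zvar Z1 \<circ> (\<partial> Z2 \<circ> (zvar Z1 ^^ k)) \<circ> (\<partial> Z2 ^^ k)"
      using Suc.IH by (simp only: fwd_op_def funpow.simps(2) o_assoc)
    then show ?case unfolding c by (simp only: funpow.simps(2) o_assoc)
  qed (simp add: fwd_op_def)
  have "fwd_op l \<circ> bwd_op l = (zvar Z1 ^^ l) \<circ> ((\<partial> Z2 ^^ l) \<circ> (\<partial> Z1 ^^ l)) \<circ> (zvar Z2 ^^ l)"
    unfolding A bwd_op_def by (simp only: o_assoc)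
  also have "(\<partial> Z2 ^^ l) \<circ> (\<partial> Z1 ^^ l) = (\<partial> Z1 ^^ l) \<circ> (\<partial> Z2 ^^ l)"
    by (rule funpow_commute_funpow) (simp add: fun_eq_iff partial_op_commute)
  finally have AC: "fwd_op l \<circ> bwd_op l = ?E1 \<circ> ?E2" by (simp only: o_assoc)
  have p1: "(\<Prod>i<l. of_nat l - of_nat i :: complex) = fact l"
  proof -
    have "(\<Prod>i<l. of_nat l - of_nat i :: complex) = of_nat (\<Prod>i<l. l - i)"
      unfolding of_nat_prod by (rule prod.cong) (simp_all add: of_nat_diff)
    then show ?thesis by (simp add: prod_diff_funpow del: of_nat_prod)
  qed
  have p2: "(\<Prod>i<l. - of_nat (Suc l) + of_nat (Suc i) :: complex) = (-1) ^ l * fact l"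
  proof -
    have "(\<Prod>i<l. - of_nat (Suc l) + of_nat (Suc i) :: complex) = (\<Prod>i<l. (-1) * (of_nat l - of_nat i))"
      by (rule prod.cong) simp_all
    also have "\<dots> = (-1) ^ l * fact l" unfolding prod.distrib p1 by simp
    finally show ?thesis .
  qed
  have "(fwd_op l \<circ> bwd_op l) \<odot>\<^bsub>?M\<^esub> ?u = scalar_op (norm_const l) \<odot>\<^bsub>?M\<^esub> ?u"
    unfolding AC I1.quotient.smult_comp[OF mem' u] I1.quotient.euler_eigenvector_powers(2)[OF u ev2]
      I1.quotient.smult_scalar_commute[OF mem'(1) u] I1.quotient.euler_eigenvector_powers(1)[OF u ev1]
      I1.quotient.smult_scalar_scalar[OF u] p1 p2
    by (simp add: norm_const_def power2_eq_square mult_ac)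
  then show ?thesis unfolding ev[OF weyl_closed(1)[OF fwd_op_mem bwd_op_mem]] .
qed

text \<open>The vacuum vector of \<open>\<M>\<^sub>1\<^sub>l\<close> is the class of \<open>\<partial>\<^sub>1\<^sup>l z\<^sub>2\<^sup>l\<close>, the inverse image of a multiple of \<open>\<delta>\<close>.
  It is not zero, for otherwise \<open>C A\<close>, hence \<open>1\<close>, would lie in the ideal of \<open>\<delta>\<close>.\<close>

lemma M1_simple_holonomic: "simple_holonomic (M1 l)"
proof -
  let ?M = "quotient_left_module \<D> (I1 l)"
  let ?e = "I1 l +>\<^bsub>\<D>\<^esub> bwd_op l"
  have e: "?e \<in> carrier ?M" by (rule I1.coset_mem[OF bwd_op_mem])
  have zero: "I1 l +>\<^bsub>\<D>\<^esub> P = \<zero>\<^bsub>?M\<^esub> \<longleftrightarrow> P \<in> I1 l" if "P \<in> carrier \<D>" for P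
    by (rule I1.coset_eq_zero_iff[OF that])
  interpret M: cyclic_vacuum ?M "{Z2, Z4}" ?e
  proof
    fix v
    show "annihilation {Z2, Z4} v \<odot>\<^bsub>?M\<^esub> ?e = \<zero>\<^bsub>?M\<^esub>"
      unfolding I1.smult_coset[OF annihilation_mem bwd_op_mem] zero[OF weyl_closed(1)[OF annihilation_mem bwd_op_mem]]
      by (rule J_Y_bwd_op[OF annihilation_in_J_Y])
  next
    show "?e \<noteq> \<zero>\<^bsub>?M\<^esub>"
    proof
      assume "?e = \<zero>\<^bsub>?M\<^esub>"
      then have "bwd_op l \<circ> fwd_op l \<in> J_Y" unfolding zero[OF bwd_op_mem] by (rule I1_fwd_op)
      from J_Y.ideal_comp[OF weyl_mem(1) this, of "- 1"]
      have "(\<lambda>p. (scalar_op (- 1) \<circ> (bwd_op l \<circ> fwd_op l)) p + ((bwd_op l \<circ> fwd_op l) p + scalar_op (- norm_const l) p)) \<in> J_Y"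
        by (rule J_Y.ideal_plus[OF _ bwd_fwd_op])
      then have "scalar_op (- norm_const l) \<in> J_Y" by (simp add: scalar_op_minus_1 add.assoc[symmetric])
      from J_Y.ideal_comp[OF weyl_mem(1) this, of "- inverse (norm_const l)"] have "id \<in> J_Y"
        using norm_const_nonzero[of l] by (simp add: comp_def scalar_op_scalar_op id_def)
      with J_Y_proper show False ..
    qed
  next
    fix x assume "x \<in> carrier ?M"
    then obtain P where P: "P \<in> carrier \<D>" "x = I1 l +>\<^bsub>\<D>\<^esub> P" by (auto simp: I1.carrier_quotient)
    let ?Q = "P \<circ> (scalar_op (inverse (norm_const l)) \<circ> fwd_op l)"
    have Q: "?Q \<in> carrier \<D>" by (intro weyl_closed P weyl_mem fwd_op_mem)
    have "(P \<circ> scalar_op (inverse (norm_const l))) \<circ> (\<lambda>p. (fwd_op l \<circ> bwd_op l) p + scalar_op (- norm_const l) p) \<in> I1 l"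
      by (intro I1.ideal_comp weyl_closed P weyl_mem fwd_bwd_op)
    also have "(P \<circ> scalar_op (inverse (norm_const l))) \<circ> (\<lambda>p. (fwd_op l \<circ> bwd_op l) p + scalar_op (- norm_const l) p) =
        (\<lambda>p. (?Q \<circ> bwd_op l) p - P p)"
      using norm_const_nonzero[of l]
      by (simp add: fun_eq_iff scalar_op_add scalar_op_scalar_op weyl_linear[OF P(1)] weyl_apply_diff[OF P(1)] scalar_op_minus_1)
    finally have "?Q \<odot>\<^bsub>?M\<^esub> ?e = x"
      unfolding P(2) I1.smult_coset[OF Q bwd_op_mem] I1.coset_eq[OF weyl_closed(1)[OF Q bwd_op_mem] P(1)] .
    with Q show "\<exists>P\<in>carrier \<D>. x = P \<odot>\<^bsub>?M\<^esub> ?e" by blast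
  qed (rule e)
  show ?thesis unfolding M1_def by (rule M.simple_holonomic)
qed

lemma M1_iso_B_YX:
  "\<exists>\<phi> \<in> left_module_iso \<D> (M1 l) B_YX. \<forall>P \<in> carrier \<D>.
    \<phi> (I1 l +>\<^bsub>\<D>\<^esub> P) = P \<odot>\<^bsub>B_YX\<^esub> (fwd_op l \<odot>\<^bsub>B_YX\<^esub> \<delta>)"
proof -
  let ?b = "scalar_op (inverse (norm_const l)) \<circ> bwd_op l"
  have b: "?b \<in> carrier \<D>" by (intro weyl_closed weyl_mem bwd_op_mem)
  have Ia: "x \<otimes>\<^bsub>\<D>\<^esub> fwd_op l \<in> J_Y" if "x \<in> I1 l" for x
    unfolding weyl_ops using that by (rule I1_fwd_op)
  have Jb: "x \<otimes>\<^bsub>\<D>\<^esub> ?b \<in> I1 l" if "x \<in> J_Y" for x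
    unfolding weyl_ops o_assoc by (rule J_Y_bwd_op[OF J_Y.ideal_scalar[OF that]])
  have ab: "fwd_op l \<otimes>\<^bsub>\<D>\<^esub> ?b \<ominus>\<^bsub>\<D>\<^esub> \<one>\<^bsub>\<D>\<^esub> \<in> I1 l"
  proof -
    have eq: "fwd_op l \<otimes>\<^bsub>\<D>\<^esub> ?b \<ominus>\<^bsub>\<D>\<^esub> \<one>\<^bsub>\<D>\<^esub> =
        scalar_op (inverse (norm_const l)) \<circ> (\<lambda>p. (fwd_op l \<circ> bwd_op l) p + scalar_op (- norm_const l) p)"
      unfolding weyl_ops weyl_minus[OF weyl_id] using norm_const_nonzero[of l]
      by (simp add: fun_eq_iff scalar_op_add scalar_op_scalar_op weyl_linear[OF fwd_op_mem] scalar_op_minus_1)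
    show ?thesis unfolding eq by (rule I1.ideal_comp[OF weyl_mem(1) fwd_bwd_op])
  qed
  have ba: "?b \<otimes>\<^bsub>\<D>\<^esub> fwd_op l \<ominus>\<^bsub>\<D>\<^esub> \<one>\<^bsub>\<D>\<^esub> \<in> J_Y"
  proof -
    have eq: "?b \<otimes>\<^bsub>\<D>\<^esub> fwd_op l \<ominus>\<^bsub>\<D>\<^esub> \<one>\<^bsub>\<D>\<^esub> =
        scalar_op (inverse (norm_const l)) \<circ> (\<lambda>p. (bwd_op l \<circ> fwd_op l) p + scalar_op (- norm_const l) p)"
      unfolding weyl_ops weyl_minus[OF weyl_id] using norm_const_nonzero[of l]
      by (simp add: fun_eq_iff scalar_op_add scalar_op_scalar_op scalar_op_minus_1)
    show ?thesis unfolding eq by (rule J_Y.ideal_comp[OF weyl_mem(1) bwd_fwd_op])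
  qed
  obtain \<phi> where \<phi>: "\<phi> \<in> left_module_iso \<D> (quotient_left_module \<D> (I1 l)) (quotient_left_module \<D> J_Y)"
    "\<And>P. P \<in> carrier \<D> \<Longrightarrow> \<phi> (I1 l +>\<^bsub>\<D>\<^esub> P) = J_Y +>\<^bsub>\<D>\<^esub> (P \<otimes>\<^bsub>\<D>\<^esub> fwd_op l)"
    using weyl.quotient_iso_right_mult[OF I1.left_ideal J_Y.left_ideal fwd_op_mem b Ia Jb ab ba] by blast
  show ?thesis
  proof (intro bexI ballI)
    show "\<phi> \<in> left_module_iso \<D> (M1 l) B_YX" unfolding M1_def B_YX_def by (rule \<phi>(1))
    fix P assume P: "P \<in> carrier \<D>"
    show "\<phi> (I1 l +>\<^bsub>\<D>\<^esub> P) = P \<odot>\<^bsub>B_YX\<^esub> (fwd_op l \<odot>\<^bsub>B_YX\<^esub> \<delta>)"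
      unfolding \<phi>(2)[OF P] delta_def B_YX_def weyl_ops J_Y.smult_coset[OF fwd_op_mem weyl_id] o_id
        J_Y.smult_coset[OF P fwd_op_mem] ..
  qed
qed


section \<open>Homomorphisms from \<open>\<M>\<^sub>3\<close>\<close>

interpretation I3: weyl_left_ideal I3
proof -
  have "zvar Z1 \<otimes>\<^bsub>\<D>\<^esub> \<partial> Z1 \<oplus>\<^bsub>\<D>\<^esub> zvar Z2 \<otimes>\<^bsub>\<D>\<^esub> \<partial> Z2 \<oplus>\<^bsub>\<D>\<^esub> \<one>\<^bsub>\<D>\<^esub> \<in> carrier \<D>"
    by (intro weyl.a_closed weyl.m_closed weyl.one_closed weyl_mem)
  then show "weyl_left_ideal I3"
    unfolding I3_def by (intro weyl_left_idealI weyl.left_ideal_left_ideal_gen) (auto simp: weyl_mem)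
qed

lemma I3_subset_I1: "I3 \<subseteq> I1 l"
  unfolding I3_def
proof (rule left_ideal_gen_least[OF I1.left_ideal])
  have "scalar_op (- of_nat l) p + scalar_op (of_nat (Suc l)) p = p" for p :: "coord cpoly"
    using scalar_op_plus[of "- of_nat l" "of_nat (Suc l)" p] by simp
  then have eq: "zvar Z1 \<otimes>\<^bsub>\<D>\<^esub> \<partial> Z1 \<oplus>\<^bsub>\<D>\<^esub> zvar Z2 \<otimes>\<^bsub>\<D>\<^esub> \<partial> Z2 \<oplus>\<^bsub>\<D>\<^esub> \<one>\<^bsub>\<D>\<^esub> =
      (\<lambda>p. ((zvar Z1 \<circ> \<partial> Z1) p + scalar_op (- of_nat l) p) + ((zvar Z2 \<circ> \<partial> Z2) p + scalar_op (of_nat (Suc l)) p))"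
    unfolding weyl_ops by (simp add: fun_eq_iff algebra_simps)
  have "zvar Z1 \<otimes>\<^bsub>\<D>\<^esub> \<partial> Z1 \<oplus>\<^bsub>\<D>\<^esub> zvar Z2 \<otimes>\<^bsub>\<D>\<^esub> \<partial> Z2 \<oplus>\<^bsub>\<D>\<^esub> \<one>\<^bsub>\<D>\<^esub> \<in> I1 l"
    unfolding eq by (rule I1.ideal_plus[OF I1_mem(1) I1_mem(3)])
  then show "{zvar Z1 \<otimes>\<^bsub>\<D>\<^esub> \<partial> Z1 \<oplus>\<^bsub>\<D>\<^esub> zvar Z2 \<otimes>\<^bsub>\<D>\<^esub> \<partial> Z2 \<oplus>\<^bsub>\<D>\<^esub> \<one>\<^bsub>\<D>\<^esub>, \<partial> Z3, zvar Z4} \<subseteq> I1 l"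
    using I1_mem(5,6) by blast
qed

lemma M3_to_M1:
  "\<exists>\<phi> \<in> left_module_hom \<D> M3 (M1 l). \<forall>P \<in> carrier \<D>. \<phi> (I3 +>\<^bsub>\<D>\<^esub> P) = I1 l +>\<^bsub>\<D>\<^esub> P"
proof -
  have "x \<otimes>\<^bsub>\<D>\<^esub> id \<in> I1 l" if "x \<in> I3" for x
    using subsetD[OF I3_subset_I1 that] by (simp only: weyl_ops o_id)
  from weyl.quotient_hom_right_mult[OF I3.left_ideal I1.left_ideal weyl_id this]
  obtain \<phi> where \<phi>: "\<phi> \<in> left_module_hom \<D> (quotient_left_module \<D> I3) (quotient_left_module \<D> (I1 l))"
    "\<And>P. P \<in> carrier \<D> \<Longrightarrow> \<phi> (I3 +>\<^bsub>\<D>\<^esub> P) = I1 l +>\<^bsub>\<D>\<^esub> (P \<otimes>\<^bsub>\<D>\<^esub> id)"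
    by blast
  show ?thesis
  proof (intro bexI ballI)
    show "\<phi> \<in> left_module_hom \<D> M3 (M1 l)" unfolding M1_def M3_def by (rule \<phi>(1))
    fix P assume "P \<in> carrier \<D>"
    from \<phi>(2)[OF this] show "\<phi> (I3 +>\<^bsub>\<D>\<^esub> P) = I1 l +>\<^bsub>\<D>\<^esub> P" by (simp only: weyl_ops o_id)
  qed
qed

text \<open>The operator is the Lagrange polynomial \<open>\<Prod> (z\<^sub>1\<partial>\<^sub>1 - i) / (j - i)\<close>, the product being over \<open>i \<in> S\<close>.\<close>

lemma I1_separating_operator:
  assumes "finite S" "j \<notin> S"
  shows "\<exists>E\<in>carrier \<D>. (\<lambda>p. E p - p) \<in> I1 j \<and> (\<forall>i\<in>S. E \<in> I1 i)"
  using assms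
proof (induction S rule: finite_induct)
  case empty
  have "(\<lambda>p. id p - p) \<in> I1 j" using I1.I.zero_closed by (simp add: weyl_ops)
  then show ?case using weyl_id by blast
next
  case (insert i S)
  then obtain E where E: "E \<in> carrier \<D>" "(\<lambda>p. E p - p) \<in> I1 j" "\<forall>k\<in>S. E \<in> I1 k" by auto
  have ij: "(of_nat j - of_nat i :: complex) \<noteq> 0" using insert.prems by auto
  let ?s = "inverse (of_nat j - of_nat i) :: complex"
  define X where "X k p = (zvar Z1 \<circ> \<partial> Z1) p + scalar_op (- of_nat k) p" for k p
  have X: "X k \<in> I1 k" for k unfolding X_def by (rule I1_mem(1))
  have Es: "E \<circ> scalar_op ?s \<in> carrier \<D>" by (intro weyl_closed E weyl_mem)
  let ?E = "E \<circ> scalar_op ?s \<circ> X i"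
  \<comment> \<open>Modulo the \<open>k\<close>-th ideal, the new factor is the scalar \<open>(k - i) / (j - i)\<close>.\<close>
  have split: "?E = (\<lambda>p. (E \<circ> scalar_op ?s \<circ> X k) p + (scalar_op (?s * (of_nat k - of_nat i)) \<circ> E) p)" for k
  proof
    fix p
    have "X i p = X k p + scalar_op (of_nat k - of_nat i) p"
      using scalar_op_plus[of "- of_nat k" "of_nat k - of_nat i" p] by (simp add: X_def)
    then show "?E p = (E \<circ> scalar_op ?s \<circ> X k) p + (scalar_op (?s * (of_nat k - of_nat i)) \<circ> E) p"
      by (simp add: scalar_op_add weyl_linear[OF E(1)] scalar_op_scalar_op)
  qed
  have "(\<lambda>p. (E \<circ> scalar_op ?s \<circ> X j) p + (E p - p)) \<in> I1 j"
    by (intro I1.ideal_plus I1.ideal_comp[OF Es X] E(2))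
  also have "(\<lambda>p. (E \<circ> scalar_op ?s \<circ> X j) p + (E p - p)) = (\<lambda>p. ?E p - p)"
    unfolding split[of j] using ij by (simp add: fun_eq_iff)
  finally have 1: "(\<lambda>p. ?E p - p) \<in> I1 j" .
  have 2: "?E \<in> I1 i" by (rule I1.ideal_comp[OF Es X])
  have 3: "?E \<in> I1 k" if "k \<in> S" for k
    unfolding split[of k]
    by (intro I1.ideal_plus I1.ideal_comp[OF Es X] I1.ideal_comp[OF weyl_mem(1)]) (use E(3) that in blast)
  from 1 2 3 I1.ideal_weyl[OF 2] show ?case by blast
qed

text \<open>Chinese remaindering: an operator with the required classes on \<open>S\<close> is corrected at \<open>j\<close> by a multiple of the operator
  that separates \<open>j\<close> from \<open>S\<close>.\<close>

lemma I1_simultaneous_representative: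
  assumes "finite S" "\<And>j. j \<in> S \<Longrightarrow> P j \<in> carrier \<D>"
  shows "\<exists>Q\<in>carrier \<D>. \<forall>j\<in>S. (\<lambda>p. Q p - P j p) \<in> I1 j"
  using assms
proof (induction S rule: finite_induct)
  case empty
  show ?case using weyl_id by blast
next
  case (insert j S)
  then obtain Q where Q: "Q \<in> carrier \<D>" "\<forall>i\<in>S. (\<lambda>p. Q p - P i p) \<in> I1 i" by auto
  obtain E where E: "E \<in> carrier \<D>" "(\<lambda>p. E p - p) \<in> I1 j" "\<forall>i\<in>S. E \<in> I1 i"
    using I1_separating_operator[OF insert.hyps] by blast
  have Pj: "P j \<in> carrier \<D>" using insert.prems by simp
  define D where "D p = P j p + scalar_op (-1) (Q p)" for p
  have D: "D \<in> carrier \<D>"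
    using weyl_closed(2)[OF Pj weyl_closed(1)[OF weyl_mem(1) Q(1), of "-1"]] by (simp add: D_def[abs_def])
  let ?Q = "\<lambda>p. Q p + (D \<circ> E) p"
  have eq: "D \<circ> (\<lambda>p. E p - p) = (\<lambda>p. ?Q p - P j p)"
  proof
    fix p
    have "D p = P j p - Q p" by (simp add: D_def scalar_op_minus_1)
    then show "(D \<circ> (\<lambda>p. E p - p)) p = ?Q p - P j p" by (simp add: weyl_apply_diff[OF D])
  qed
  have 1: "(\<lambda>p. ?Q p - P j p) \<in> I1 j" unfolding eq[symmetric] by (rule I1.ideal_comp[OF D E(2)])
  have 2: "(\<lambda>p. ?Q p - P i p) \<in> I1 i" if i: "i \<in> S" for i
  proof -
    have "(\<lambda>p. (Q p - P i p) + (D \<circ> E) p) \<in> I1 i"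
      using Q(2) E(3) i by (intro I1.ideal_plus I1.ideal_comp[OF D]) blast+
    then show ?thesis by (simp add: algebra_simps)
  qed
  have mem: "?Q \<in> carrier \<D>" by (intro weyl_closed Q D E)
  show ?case
  proof (rule bexI[OF _ mem], rule ballI)
    fix i assume "i \<in> insert j S"
    then show "(\<lambda>p. ?Q p - P i p) \<in> I1 i" using 1 2[of i] by (cases "i = j") simp_all
  qed
qed

theorem theorem6:
  fixes l :: nat
  shows
    "(\<exists>\<phi> \<in> left_module_iso \<D> (M1 l) B_YX. \<forall>P \<in> carrier \<D>.
        \<phi> (I1 l +>\<^bsub>\<D>\<^esub> P) = P \<odot>\<^bsub>B_YX\<^esub> ((zvar Z1 \<otimes>\<^bsub>\<D>\<^esub> \<partial> Z2) [^]\<^bsub>\<D>\<^esub> l \<odot>\<^bsub>B_YX\<^esub> \<delta>))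
     \<and> simple_holonomic (M1 l)
     \<and> (\<exists>\<phi> \<in> left_module_hom \<D> M3 (M1 l).
          (\<forall>P \<in> carrier \<D>. \<phi> (I3 +>\<^bsub>\<D>\<^esub> P) = I1 l +>\<^bsub>\<D>\<^esub> P) \<and>
          \<phi> ` carrier M3 = carrier (M1 l))
     \<and> (\<forall>L::nat. L > 0 \<longrightarrow>
          (\<exists>\<phi> \<in> left_module_hom \<D> M3 (direct_sum_module {0..L} M1).
             (\<forall>P \<in> carrier \<D>. \<phi> (I3 +>\<^bsub>\<D>\<^esub> P) = (\<lambda>j\<in>{0..L}. I1 j +>\<^bsub>\<D>\<^esub> P)) \<and>
             \<phi> ` carrier M3 = carrier (direct_sum_module {0..L} M1)))"
proof (intro conjI allI impI)
  show "\<exists>\<phi> \<in> left_module_iso \<D> (M1 l) B_YX. \<forall>P \<in> carrier \<D>.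
        \<phi> (I1 l +>\<^bsub>\<D>\<^esub> P) = P \<odot>\<^bsub>B_YX\<^esub> ((zvar Z1 \<otimes>\<^bsub>\<D>\<^esub> \<partial> Z2) [^]\<^bsub>\<D>\<^esub> l \<odot>\<^bsub>B_YX\<^esub> \<delta>)"
    using M1_iso_B_YX[of l] unfolding weyl_pow weyl_ops fwd_op_def .
next
  show "simple_holonomic (M1 l)" by (rule M1_simple_holonomic)
next
  obtain \<phi> where \<phi>: "\<phi> \<in> left_module_hom \<D> M3 (M1 l)"
    "\<And>P. P \<in> carrier \<D> \<Longrightarrow> \<phi> (I3 +>\<^bsub>\<D>\<^esub> P) = I1 l +>\<^bsub>\<D>\<^esub> P"
    using M3_to_M1[of l] by blast
  have "\<phi> ` carrier M3 = carrier (M1 l)"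
    unfolding M3_def M1_def I3.carrier_quotient I1.carrier_quotient image_image
    by (rule image_cong[OF refl \<phi>(2)])
  with \<phi> show "\<exists>\<phi> \<in> left_module_hom \<D> M3 (M1 l).
      (\<forall>P \<in> carrier \<D>. \<phi> (I3 +>\<^bsub>\<D>\<^esub> P) = I1 l +>\<^bsub>\<D>\<^esub> P) \<and> \<phi> ` carrier M3 = carrier (M1 l)"
    by blast
next
  fix L :: nat assume "L > 0"
  let ?S = "direct_sum_module {0..L} M1"
  have "\<forall>j. \<exists>\<psi>. \<psi> \<in> left_module_hom \<D> M3 (M1 j) \<and>
      (\<forall>P\<in>carrier \<D>. \<psi> (I3 +>\<^bsub>\<D>\<^esub> P) = I1 j +>\<^bsub>\<D>\<^esub> P)"
    using M3_to_M1 unfolding Bex_def by (rule allI)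
  then obtain \<psi> where \<psi>: "\<And>j. \<psi> j \<in> left_module_hom \<D> M3 (M1 j)"
    "\<And>j P. P \<in> carrier \<D> \<Longrightarrow> \<psi> j (I3 +>\<^bsub>\<D>\<^esub> P) = I1 j +>\<^bsub>\<D>\<^esub> P"
    by metis
  define \<phi> where "\<phi> X = (\<lambda>j\<in>{0..L}. \<psi> j X)" for X
  have \<phi>: "\<phi> (I3 +>\<^bsub>\<D>\<^esub> P) = (\<lambda>j\<in>{0..L}. I1 j +>\<^bsub>\<D>\<^esub> P)" if "P \<in> carrier \<D>" for P
    unfolding \<phi>_def using \<psi>(2)[OF that] by simp
  have carrier: "carrier ?S = (\<Pi>\<^sub>E j\<in>{0..L}. carrier (M1 j))"
    by (simp add: direct_sum_module_def)
  have hom: "\<phi> \<in> left_module_hom \<D> M3 ?S"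
    unfolding left_module_hom_def carrier
  proof (intro CollectI conjI ballI)
    show "\<phi> \<in> carrier M3 \<rightarrow> (\<Pi>\<^sub>E j\<in>{0..L}. carrier (M1 j))"
    proof (intro funcsetI)
      fix x assume "x \<in> carrier M3"
      with \<psi>(1) have "\<psi> j x \<in> carrier (M1 j)" for j
        unfolding left_module_hom_def by blast
      then show "\<phi> x \<in> (\<Pi>\<^sub>E j\<in>{0..L}. carrier (M1 j))" by (simp add: \<phi>_def)
    qed
  next
    fix x y assume "x \<in> carrier M3" "y \<in> carrier M3"
    with \<psi>(1) have "\<psi> j (x \<oplus>\<^bsub>M3\<^esub> y) = \<psi> j x \<oplus>\<^bsub>M1 j\<^esub> \<psi> j y" for j
      unfolding left_module_hom_def by blast
    then show "\<phi> (x \<oplus>\<^bsub>M3\<^esub> y) = \<phi> x \<oplus>\<^bsub>?S\<^esub> \<phi> y"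
      by (simp add: \<phi>_def direct_sum_module_def restrict_def fun_eq_iff)
  next
    fix a x assume "a \<in> carrier \<D>" "x \<in> carrier M3"
    with \<psi>(1) have "\<psi> j (a \<odot>\<^bsub>M3\<^esub> x) = a \<odot>\<^bsub>M1 j\<^esub> \<psi> j x" for j
      unfolding left_module_hom_def by blast
    then show "\<phi> (a \<odot>\<^bsub>M3\<^esub> x) = a \<odot>\<^bsub>?S\<^esub> \<phi> x"
      by (simp add: \<phi>_def direct_sum_module_def restrict_def fun_eq_iff)
  qed
  have "\<phi> ` carrier M3 = carrier ?S"
  proof
    show "\<phi> ` carrier M3 \<subseteq> carrier ?S" using hom by (auto simp: left_module_hom_def)
    show "carrier ?S \<subseteq> \<phi> ` carrier M3"
    proof
      fix f assume f: "f \<in> carrier ?S"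
      have "\<forall>j\<in>{0..L}. \<exists>P\<in>carrier \<D>. f j = I1 j +>\<^bsub>\<D>\<^esub> P"
        using f unfolding carrier M1_def I1.carrier_quotient by blast
      then obtain P where P: "\<And>j. j \<in> {0..L} \<Longrightarrow> P j \<in> carrier \<D>"
          "\<And>j. j \<in> {0..L} \<Longrightarrow> f j = I1 j +>\<^bsub>\<D>\<^esub> P j"
        by metis
      obtain Q where Q: "Q \<in> carrier \<D>" "\<forall>j\<in>{0..L}. (\<lambda>p. Q p - P j p) \<in> I1 j"
        using I1_simultaneous_representative[of "{0..L}" P] P(1) by auto
      have "\<phi> (I3 +>\<^bsub>\<D>\<^esub> Q) = f"
      proof
        fix j
        show "\<phi> (I3 +>\<^bsub>\<D>\<^esub> Q) j = f j"
        proof (cases "j \<in> {0..L}")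
          case True
          with Q P show ?thesis by (simp add: \<phi> I1.coset_eq)
        next
          case False
          with f show ?thesis unfolding carrier \<phi>[OF Q(1)] by (auto simp: PiE_def extensional_def)
        qed
      qed
      moreover have "I3 +>\<^bsub>\<D>\<^esub> Q \<in> carrier M3" unfolding M3_def by (rule I3.coset_mem[OF Q(1)])
      ultimately show "f \<in> \<phi> ` carrier M3" by blast
    qed
  qed
  then show "\<exists>\<phi> \<in> left_module_hom \<D> M3 ?S.
      (\<forall>P \<in> carrier \<D>. \<phi> (I3 +>\<^bsub>\<D>\<^esub> P) = (\<lambda>j\<in>{0..L}. I1 j +>\<^bsub>\<D>\<^esub> P)) \<and>
      \<phi> ` carrier M3 = carrier ?S"
    by (intro bexI[OF _ hom] conjI ballI \<phi>)
qed

end
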